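(* Let $\tau:\mathbb{Z}/2\mathbb{Z}\to\mathcal{C}_s$ be a faithful representation, where $\mathcal{C}_s\subset O(\mathbb{R}^2)$ is the group of order $2$ generated by a reflection, let $G$ be a finite simple $\mathbb{Z}/2\mathbb{Z}$-symmetric graph with action $\theta:\mathbb{Z}/2\mathbb{Z}\to\mathrm{Aut}(G)$ free on $V(G)$, and let $(G,p)$ be a $\mathcal{C}_s$-regular framework in $\mathbb{R}^2$ with respect to $\theta$ and $\tau$. Then $$\operatorname{rank}R(G,p)=\operatorname{rank}\mathcal{M}_{2,3,1}(H,\psi)+\operatorname{rank}\mathcal{M}_{2,3,2}(H,\psi),$$ where $(H,\psi)$ denotes the quotient gain graph of $G$.
   Context: A framework $(G,p)$ in $\mathbb{R}^2$ is a finite simple graph $G$ with $p:V(G)\to\mathbb{R}^2$ such that $p(u)\ne p(v)$ for all edges $\{u,v\}$. The rigidity matrix $R(G,p)$ is the $|E(G)|\times 2|V(G)|$ matrix whose row for $\{u,v\}$ has $(p(u)-p(v))^\top$ in the columns of $u$, $(p(v)-p(u))^\top$ in the columns of $v$, and $0$ elsewhere. Let $\Gamma=\mathbb{Z}/2\mathbb{Z}$. An action is a homomorphism $\theta:\Gamma\to\mathrm{Aut}(G)$, written $\gamma v=\theta(\gamma)(v)$; free on $V(G)$ means no non-identity element fixes a vertex (edges may be fixed). $(G,p)$ is $\Gamma$-symmetric with respect to $\theta,\tau$ if $\tau(\gamma)p(v)=p(\gamma v)$ for all $\gamma,v$. It is $\mathcal{C}_s$-regular if it is $\Gamma$-symmetric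 and $\operatorname{rank}R(G,p)$ is maximal among all $\Gamma$-symmetric realizations of $G$ (with respect to the same $\theta,\tau$). Quotient gain graph $(H,\psi)$: choose one representative vertex in each vertex orbit. $V(H)$ is the set of vertex orbits, $E(H)$ the set of edge orbits; an edge orbit joining the orbits of representatives $u,v$ has the form $\{\{\gamma u,\gamma hv\}:\gamma\in\Gamma\}$ and is a directed edge (possibly a loop) from the orbit of $u$ to the orbit of $v$ with gain $\psi=h$. Gain-sparsity: a cycle (including loops and pairs of parallel edges) in $H$ is balanced if the product of its edge gains along the cycle (inverted for edges traversed backwards) is the identity. $F\subseteq E(H)$ is balanced if all its cycles are balanced. $V(F)$ is the set of endpoints of edges in $F$. An edge set $E$ is $(k,\ell,m)$-gain-sparse if $|F|\le k|V(F)|-\ell$ for every nonempty balanced $F\subseteq E$ and $|F|\le k|V(F)|-m$ for every nonempty $F\subseteq E$. For $m\in\{1,2\}$ the $(2,3,m)$-gain-sparse subsets of $E(H)$ are the independent sets of a matroid $\mathcal{M}_{2,3,m}(H,\psi)$ on $E(H)$; its rank is the maximum size of a $(2,3,m)$-gain-sparse subset of $E(H)$. *)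

theory Defs
  imports
    "HOL-Analysis.Analysis"
    "HOL-Library.Z2"
    "Graph_Theory.Digraph"
begin

section \<open>Frameworks and the rigidity matrix\<close>

definition simple_graph :: "'v set \<Rightarrow> 'v set set \<Rightarrow> bool" where
  "simple_graph V E \<longleftrightarrow> finite V \<and> (\<forall>e\<in>E. \<exists>u\<in>V. \<exists>v\<in>V. u \<noteq> v \<and> e = {u, v})"

definition framework :: "'v set \<Rightarrow> 'v set set \<Rightarrow> ('v \<Rightarrow> real^2) \<Rightarrow> bool" where
  "framework V E p \<longleftrightarrow> simple_graph V E \<and> (\<forall>u v. {u, v} \<in> E \<longrightarrow> p u \<noteq> p v)"

text \<open>
  The row index type consists of all sets of vertices and the column index type of all pairs
  (vertex, coordinate) over the ambient finite type. Rows of non-edges and columns of non-vertices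
  are zero, so this is the usual \<open>|E| \<times> 2|V|\<close> matrix padded by zeros, which does not affect its
  rank. In the row of \<open>e = {w, u}\<close>, the columns of \<open>w\<close> hold \<open>p w - p u\<close>.
\<close>

definition rigidity_matrix ::
    "('v::finite) set set \<Rightarrow> ('v \<Rightarrow> real^2) \<Rightarrow> real^('v \<times> 2)^('v set)" where
  "rigidity_matrix E p =
    (\<chi> e wi. case wi of (w, i) \<Rightarrow>
       if e \<in> E \<and> w \<in> e then (p w - p (THE u. e = {w, u})) $ i else 0)"

lemma rigidity_matrix_edge:
  assumes "{u, v} \<in> E" "u \<noteq> v"
  shows "rigidity_matrix E p $ {u, v} $ (w, i) =
    (if w = u then (p u - p v) $ i else if w = v then (p v - p u) $ i else 0)"
proof -
  have "(THE x. {u, v} = {u, x}) = v" "(THE x. {u, v} = {v, x}) = u"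
    using assms(2) by (auto simp: doubleton_eq_iff)
  then show ?thesis
    using assms by (auto simp: rigidity_matrix_def)
qed

lemma rank_rigidity_matrix:
  "rank (rigidity_matrix E p) = dim ((\<lambda>e. rigidity_matrix E p $ e) ` E)"
proof -
  let ?A = "rigidity_matrix E p"
  have zero: "?A $ e = 0" if "e \<notin> E" for e
    using that by (auto simp: rigidity_matrix_def vec_eq_iff)
  have "span (rows ?A) = span ((\<lambda>e. ?A $ e) ` E)"
  proof (rule span_eq[THEN iffD2], intro conjI subsetI)
    fix x assume "x \<in> rows ?A"
    then obtain e where "x = ?A $ e"
      by (auto simp: rows_def row_def)
    then show "x \<in> span ((\<lambda>e. ?A $ e) ` E)"
      using zero[of e] by (cases "e \<in> E") (auto intro: span_base span_zero)
  next
    fix x assume "x \<in> (\<lambda>e. ?A $ e) ` E"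
    then show "x \<in> span (rows ?A)"
      by (auto intro!: span_base simp: rows_def row_def)
  qed
  then show ?thesis
    by (metis row_rank_def dim_span)
qed


section \<open>Symmetry\<close>

text \<open>Groups are written additively; in particular \<^typ>\<open>bit\<close> is the additive group of order two.\<close>

definition graph_automorphism :: "'v set \<Rightarrow> 'v set set \<Rightarrow> ('v \<Rightarrow> 'v) \<Rightarrow> bool" where
  "graph_automorphism V E f \<longleftrightarrow>
     bij_betw f V V \<and> (\<forall>u\<in>V. \<forall>v\<in>V. {f u, f v} \<in> E \<longleftrightarrow> {u, v} \<in> E)"

definition graph_action :: "'v set \<Rightarrow> 'v set set \<Rightarrow> ('g::group_add \<Rightarrow> 'v \<Rightarrow> 'v) \<Rightarrow> bool" where
  "graph_action V E \<theta> \<longleftrightarrow>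
     (\<forall>\<gamma>. graph_automorphism V E (\<theta> \<gamma>)) \<and>
     (\<forall>v\<in>V. \<theta> 0 v = v) \<and>
     (\<forall>\<gamma> \<delta>. \<forall>v\<in>V. \<theta> (\<gamma> + \<delta>) v = \<theta> \<gamma> (\<theta> \<delta> v))"

definition free_on :: "'v set \<Rightarrow> ('g::group_add \<Rightarrow> 'v \<Rightarrow> 'v) \<Rightarrow> bool" where
  "free_on V \<theta> \<longleftrightarrow> (\<forall>\<gamma>. \<gamma> \<noteq> 0 \<longrightarrow> (\<forall>v\<in>V. \<theta> \<gamma> v \<noteq> v))"

definition reflection_matrix :: "real^2 \<Rightarrow> real^2^2" where
  "reflection_matrix n = matrix (\<lambda>x. x - (2 * (x \<bullet> n) / (n \<bullet> n)) *\<^sub>R n)"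

text \<open>For \<open>n \<noteq> 0\<close>, the group generated by the reflection in the line through 0 orthogonal to \<open>n\<close>.\<close>

definition reflection_group :: "real^2 \<Rightarrow> (real^2^2) set" where
  "reflection_group n = {mat 1, reflection_matrix n}"

definition faithful_representation :: "('g::group_add \<Rightarrow> real^2^2) \<Rightarrow> (real^2^2) set \<Rightarrow> bool" where
  "faithful_representation \<tau> C \<longleftrightarrow>
     range \<tau> \<subseteq> C \<and> (\<forall>\<gamma> \<delta>. \<tau> (\<gamma> + \<delta>) = \<tau> \<gamma> ** \<tau> \<delta>) \<and> inj \<tau>"

definition symmetric_framework ::
    "'v set \<Rightarrow> 'v set set \<Rightarrow> ('g::group_add \<Rightarrow> 'v \<Rightarrow> 'v) \<Rightarrow> ('g \<Rightarrow> real^2^2) \<Rightarrow> ('v \<Rightarrow> real^2) \<Rightarrow> bool" where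
  "symmetric_framework V E \<theta> \<tau> p \<longleftrightarrow>
     framework V E p \<and> (\<forall>\<gamma>. \<forall>v\<in>V. \<tau> \<gamma> *v p v = p (\<theta> \<gamma> v))"

definition symmetric_regular ::
    "('v::finite) set \<Rightarrow> 'v set set \<Rightarrow> ('g::group_add \<Rightarrow> 'v \<Rightarrow> 'v) \<Rightarrow> ('g \<Rightarrow> real^2^2) \<Rightarrow> ('v \<Rightarrow> real^2) \<Rightarrow> bool" where
  "symmetric_regular V E \<theta> \<tau> p \<longleftrightarrow>
     symmetric_framework V E \<theta> \<tau> p \<and>
     (\<forall>q. symmetric_framework V E \<theta> \<tau> q \<longrightarrow>
        rank (rigidity_matrix E q) \<le> rank (rigidity_matrix E p))"


section \<open>Quotient gain graphs\<close>

definition vertex_orbit :: "('g \<Rightarrow> 'v \<Rightarrow> 'v) \<Rightarrow> 'v \<Rightarrow> 'v set" where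
  "vertex_orbit \<theta> v = range (\<lambda>\<gamma>. \<theta> \<gamma> v)"

definition edge_orbit :: "('g \<Rightarrow> 'v \<Rightarrow> 'v) \<Rightarrow> 'v set \<Rightarrow> 'v set set" where
  "edge_orbit \<theta> e = range (\<lambda>\<gamma>. \<theta> \<gamma> ` e)"

text \<open>
  The quotient gain graph depends on the chosen set \<open>R\<close> of orbit representatives and on the chosen
  orientations of the edge orbits, so it is given as a relation that admits every such choice.
\<close>

definition quotient_gain_graph ::
    "'v set \<Rightarrow> 'v set set \<Rightarrow> ('g::group_add \<Rightarrow> 'v \<Rightarrow> 'v) \<Rightarrow> 'v set \<Rightarrow>
     ('v set, 'v set set) pre_digraph \<Rightarrow> ('v set set \<Rightarrow> 'g) \<Rightarrow> bool" where
  "quotient_gain_graph V E \<theta> R H \<psi> \<longleftrightarrow>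
     R \<subseteq> V \<and> (\<forall>v\<in>V. \<exists>!r. r \<in> R \<and> r \<in> vertex_orbit \<theta> v) \<and>
     verts H = vertex_orbit \<theta> ` V \<and>
     arcs H = edge_orbit \<theta> ` E \<and>
     (\<forall>a\<in>arcs H. \<exists>u\<in>R. \<exists>v\<in>R. \<exists>h.
        a = {{\<theta> \<gamma> u, \<theta> (\<gamma> + h) v} | \<gamma>. True} \<and>
        tail H a = vertex_orbit \<theta> u \<and> head H a = vertex_orbit \<theta> v \<and> \<psi> a = h)"


section \<open>Gain-sparsity\<close>

text \<open>
  A traversed arc is a pair \<open>(a, d)\<close>, where \<open>d\<close> tells whether the arc \<open>a\<close> is traversed in its own
  direction. Arcs on a cycle are pairwise distinct, so an arc followed by its own reversal is not a
  cycle, whereas loops and pairs of parallel arcs are.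
\<close>

definition start_vertex :: "('w, 'e) pre_digraph \<Rightarrow> 'e \<times> bool \<Rightarrow> 'w" where
  "start_vertex H s = (if snd s then tail H (fst s) else head H (fst s))"

definition end_vertex :: "('w, 'e) pre_digraph \<Rightarrow> 'e \<times> bool \<Rightarrow> 'w" where
  "end_vertex H s = (if snd s then head H (fst s) else tail H (fst s))"

definition gain_cycle :: "('w, 'e) pre_digraph \<Rightarrow> ('e \<times> bool) list \<Rightarrow> bool" where
  "gain_cycle H c \<longleftrightarrow>
     c \<noteq> [] \<and> fst ` set c \<subseteq> arcs H \<and>
     distinct (map fst c) \<and> distinct (map (start_vertex H) c) \<and>
     (\<forall>i. Suc i < length c \<longrightarrow> end_vertex H (c ! i) = start_vertex H (c ! Suc i)) \<and>
     end_vertex H (last c) = start_vertex H (hd c)"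

definition cycle_gain :: "('e \<Rightarrow> 'g::group_add) \<Rightarrow> ('e \<times> bool) list \<Rightarrow> 'g" where
  "cycle_gain \<psi> c = (\<Sum>(a, d)\<leftarrow>c. if d then \<psi> a else - \<psi> a)"

definition balanced :: "('w, 'e) pre_digraph \<Rightarrow> ('e \<Rightarrow> 'g::group_add) \<Rightarrow> 'e set \<Rightarrow> bool" where
  "balanced H \<psi> F \<longleftrightarrow> (\<forall>c. gain_cycle H c \<and> fst ` set c \<subseteq> F \<longrightarrow> cycle_gain \<psi> c = 0)"

definition arc_verts :: "('w, 'e) pre_digraph \<Rightarrow> 'e set \<Rightarrow> 'w set" where
  "arc_verts H F = tail H ` F \<union> head H ` F"

definition gain_sparse ::
    "('w, 'e) pre_digraph \<Rightarrow> ('e \<Rightarrow> 'g::group_add) \<Rightarrow> nat \<Rightarrow> nat \<Rightarrow> nat \<Rightarrow> 'e set \<Rightarrow> bool" where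
  "gain_sparse H \<psi> k l m I \<longleftrightarrow>
     (\<forall>F\<subseteq>I. F \<noteq> {} \<longrightarrow>
        (balanced H \<psi> F \<longrightarrow> int (card F) \<le> int k * int (card (arc_verts H F)) - int l) \<and>
        int (card F) \<le> int k * int (card (arc_verts H F)) - int m)"

definition gain_matroid_rank ::
    "('w, 'e) pre_digraph \<Rightarrow> ('e \<Rightarrow> 'g::group_add) \<Rightarrow> nat \<Rightarrow> nat \<Rightarrow> nat \<Rightarrow> nat" where
  "gain_matroid_rank H \<psi> k l m = Max (card ` {I. I \<subseteq> arcs H \<and> gain_sparse H \<psi> k l m I})"

end

theory Submission
  imports Defs
begin

text \<open>
  In coordinates along and across the mirror, the rigidity matrix of a symmetric framework splits
  into a symmetric and an antisymmetric block, each with one row per arc of the quotient gain graph.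
  With \<open>\<beta> = e_u - e_v\<close> and \<open>\<alpha> = e_u - \<epsilon> e_v\<close>, where \<open>\<epsilon>\<close> is the sign of the gain, the rows at
  \<open>(x, y)\<close> are \<open>((\<beta> x) \<beta>, (\<alpha> y) \<alpha>)\<close> and \<open>((\<beta> x) \<alpha>, (\<alpha> y) \<beta>)\<close>. Trivial motions show that independent
  rows are gain-sparse, so each block has at most the rank of its count matroid.

  For the converse, \<open>(2,3,m)\<close>-sparsity says \<open>|F| < r(\<alpha>, F) + r(\<beta>, F)\<close> for \<open>m = 2\<close> and
  \<open>|F| < 2 r(\<alpha>, F)\<close> for \<open>m = 1\<close>, i.e. independence in a Dilworth truncation. The antisymmetric rows are
  the intersections of the planes spanned by \<open>\<alpha>\<close> and \<open>\<beta>\<close> with the hyperplane orthogonal to \<open>(-y, x)\<close>, so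
  Lovasz's generic hyperplane theorem makes sparse sets independent. In the symmetric case the same
  theorem applies to the planes spanned by \<open>\<alpha>\<close> and \<open>\<alpha>\<close>, which is half-turn symmetric rigidity; a
  projective map turns the half-turn into the reflection. Independence is an open dense condition,
  so one point realises both ranks, and regularity transfers this to the given framework.
\<close>

section \<open>Independent families and generic points\<close>

text \<open>An indexed family rather than a set of vectors: two arcs with equal rows then count as
  dependent, so that independence can be compared with cardinalities of arc sets.\<close>

definition indep_family :: "'e set \<Rightarrow> ('e \<Rightarrow> 'a::real_vector) \<Rightarrow> bool" where
  "indep_family I r \<longleftrightarrow> (\<forall>c. (\<Sum>e\<in>I. c e *\<^sub>R r e) = 0 \<longrightarrow> (\<forall>e\<in>I. c e = 0))"

lemma indep_familyD: "indep_family I r \<Longrightarrow> (\<Sum>e\<in>I. c e *\<^sub>R r e) = 0 \<Longrightarrow> e \<in> I \<Longrightarrow> c e = 0"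
  by (auto simp: indep_family_def)

lemma indep_family_subset:
  assumes "indep_family I r" "J \<subseteq> I" "finite I"
  shows "indep_family J r"
  unfolding indep_family_def
proof (intro allI impI)
  fix c assume c: "(\<Sum>e\<in>J. c e *\<^sub>R r e) = 0"
  have "(\<Sum>e\<in>I. (if e \<in> J then c e else 0) *\<^sub>R r e) = (\<Sum>e\<in>J. c e *\<^sub>R r e)"
    by (rule sum.mono_neutral_cong_right) (use assms in auto)
  then show "\<forall>e\<in>J. c e = 0"
    using indep_familyD[OF assms(1), of "\<lambda>e. if e \<in> J then c e else 0"] c assms(2) by force
qed

lemma indep_family_iff:
  assumes "finite I"
  shows "indep_family I r \<longleftrightarrow> inj_on r I \<and> independent (r ` I)"
proof
  assume ind: "indep_family I r"
  have inj: "inj_on r I"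
  proof (rule inj_onI, rule ccontr)
    fix x y assume xy: "x \<in> I" "y \<in> I" "r x = r y" "x \<noteq> y"
    let ?c = "\<lambda>e. if e = x then 1 else if e = y then -1 else (0::real)"
    have "(\<Sum>e\<in>I. ?c e *\<^sub>R r e) = (\<Sum>e\<in>{x,y}. ?c e *\<^sub>R r e)"
      by (rule sum.mono_neutral_right) (use xy assms in auto)
    also have "\<dots> = 0" using xy by simp
    finally show False using indep_familyD[OF ind, of ?c x] xy by simp
  qed
  have "independent (r ` I)"
  proof (rule independent_if_scalars_zero)
    fix f x assume f: "(\<Sum>x\<in>r ` I. f x *\<^sub>R x) = 0" and x: "x \<in> r ` I"
    then have "(\<Sum>e\<in>I. f (r e) *\<^sub>R r e) = 0" by (simp add: sum.reindex[OF inj])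
    with x show "f x = 0" using indep_familyD[OF ind, of "\<lambda>e. f (r e)"] by auto
  qed (use assms in simp)
  with inj show "inj_on r I \<and> independent (r ` I)" by simp
next
  assume R: "inj_on r I \<and> independent (r ` I)"
  show "indep_family I r" unfolding indep_family_def
  proof (intro allI impI ballI)
    fix c e assume c: "(\<Sum>e\<in>I. c e *\<^sub>R r e) = 0" and e: "e \<in> I"
    have "(\<Sum>x\<in>r ` I. c (the_inv_into I r x) *\<^sub>R x) = 0"
      using c R by (simp add: sum.reindex the_inv_into_f_f)
    then have "c (the_inv_into I r (r e)) = 0"
      by (intro independentD[of "r ` I" "r ` I"]) (use R e assms in auto)
    then show "c e = 0" using R e by (simp add: the_inv_into_f_f)
  qed
qed

lemma dim_indep_family:
  fixes r :: "'e \<Rightarrow> 'a::euclidean_space"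
  assumes "finite I" "indep_family I r"
  shows "dim (r ` I) = card I"
  using assms by (simp add: indep_family_iff dim_eq_card_independent card_image)

text \<open>Applying \<open>f\<close> turns a dependency of \<open>r\<close> into one of
  \<open>s\<close>. The nonzero factors \<open>c e\<close> allow for a projective change of
  coordinates, which carries rows to rows only up to scale.\<close>

lemma indep_family_linear_image:
  assumes "linear f" "\<And>e. e \<in> I \<Longrightarrow> f (r e) = c e *\<^sub>R s e" "indep_family I s"
    "\<And>e. e \<in> I \<Longrightarrow> c e \<noteq> 0"
  shows "indep_family I r"
  unfolding indep_family_def
proof (intro allI impI ballI)
  fix b e assume b: "(\<Sum>e\<in>I. b e *\<^sub>R r e) = 0" and e: "e \<in> I"
  interpret linear f by fact
  have "(\<Sum>e\<in>I. (b e * c e) *\<^sub>R s e) = (\<Sum>e\<in>I. b e *\<^sub>R f (r e))"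
    using assms(2) by simp
  also have "\<dots> = f (\<Sum>e\<in>I. b e *\<^sub>R r e)"
    by (simp add: sum scaleR)
  finally have "(\<Sum>e\<in>I. (b e * c e) *\<^sub>R s e) = 0" using b by (simp add: zero)
  from indep_familyD[OF assms(3) this e] assms(4)[OF e] show "b e = 0" by simp
qed

lemma ex_indep_family_spanning:
  fixes r :: "'e \<Rightarrow> 'a::euclidean_space"
  assumes "finite A"
  obtains I where "I \<subseteq> A" "indep_family I r" "card I = dim (r ` A)"
proof -
  obtain B where B: "B \<subseteq> r ` A" "independent B" "r ` A \<subseteq> span B" "card B = dim (r ` A)"
    using basis_exists by blast
  obtain I where I: "I \<subseteq> A" "inj_on r I" "r ` I = B"
    using B(1) subset_image_inj by metis
  have "finite I" using I(1) assms finite_subset by blast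
  then have "indep_family I r" using I B by (simp add: indep_family_iff)
  with I B show thesis by (metis that card_image)
qed

text \<open>Dependencies at varying points are normalised and extended by zero, so that they all lie
  on one compact sphere where a limit can be taken.\<close>

lemma not_indep_family_unit:
  fixes r :: "'e::finite \<Rightarrow> 'a::real_vector"
  assumes "\<not> indep_family I r"
  obtains \<mu> :: "real^'e" where "norm \<mu> = 1" "\<And>e. e \<notin> I \<Longrightarrow> \<mu> $ e = 0" "(\<Sum>e\<in>I. \<mu> $ e *\<^sub>R r e) = 0"
proof -
  obtain c e where c: "(\<Sum>e\<in>I. c e *\<^sub>R r e) = 0" "e \<in> I" "c e \<noteq> 0"
    using assms by (auto simp: indep_family_def)
  define \<nu> :: "real^'e" where "\<nu> = (\<chi> e. if e \<in> I then c e else 0)"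
  have "\<nu> $ e \<noteq> 0" using c by (simp add: \<nu>_def)
  then have nz: "\<nu> \<noteq> 0" by auto
  define \<mu> where "\<mu> = (1 / norm \<nu>) *\<^sub>R \<nu>"
  have "(\<Sum>e\<in>I. \<mu> $ e *\<^sub>R r e) = (1 / norm \<nu>) *\<^sub>R (\<Sum>e\<in>I. c e *\<^sub>R r e)"
    by (simp add: \<mu>_def \<nu>_def scaleR_right.sum)
  moreover have "norm \<mu> = 1" using nz by (simp add: \<mu>_def)
  moreover have "\<mu> $ e = 0" if "e \<notin> I" for e using that by (simp add: \<mu>_def \<nu>_def)
  ultimately show thesis using that c(1) by simp
qed

lemma dim_le_1_if_proportional:
  assumes "\<And>x y. x \<in> S \<Longrightarrow> y \<in> S \<Longrightarrow> x \<noteq> 0 \<Longrightarrow> \<exists>c. y = c *\<^sub>R x"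
  shows "dim (S :: 'a::euclidean_space set) \<le> 1"
proof (cases "S \<subseteq> {0}")
  case True then show ?thesis using dim_eq_0[of S] by linarith
next
  case False
  then obtain x where x: "x \<in> S" "x \<noteq> 0" by auto
  have "S \<subseteq> span {x}" using assms[OF x(1) _ x(2)] by (auto simp: span_singleton)
  then have "dim S \<le> card {x}" by (intro dim_le_card) auto
  then show ?thesis by simp
qed

section \<open>Properties that hold off the zero set of a nonzero polynomial\<close>

definition generic :: "('a::real_normed_vector \<Rightarrow> bool) \<Rightarrow> bool" where
  "generic P \<longleftrightarrow>
     (\<exists>f. real_polynomial_function f \<and> (\<exists>h. f h \<noteq> 0) \<and> (\<forall>h. f h \<noteq> 0 \<longrightarrow> P h))"

lemma generic_polynomial:
  assumes "real_polynomial_function f" "f h \<noteq> 0" "\<And>h. f h \<noteq> 0 \<Longrightarrow> P h"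
  shows "generic P"
  using assms by (auto simp: generic_def)

lemma generic_ex: "generic P \<Longrightarrow> \<exists>h. P h"
  by (auto simp: generic_def)

lemma generic_True: "generic (\<lambda>_. True)"
  by (rule generic_polynomial[of "\<lambda>_. 1"]) auto

text \<open>On the line through a point where \<open>f\<close> is nonzero and a point where
  \<open>g\<close> is nonzero, both restrict to nonzero univariate polynomials. These have finitely
  many roots, so \<open>f h * g h\<close> is nonzero somewhere on the line.\<close>

lemma generic_conj:
  assumes "generic P" "generic Q"
  shows "generic (\<lambda>h. P h \<and> Q h)"
proof -
  obtain f a where f: "real_polynomial_function f" "f a \<noteq> 0" "\<And>h. f h \<noteq> 0 \<Longrightarrow> P h"
    using assms(1) by (auto simp: generic_def)
  obtain g b where g: "real_polynomial_function g" "g b \<noteq> 0" "\<And>h. g h \<noteq> 0 \<Longrightarrow> Q h"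
    using assms(2) by (auto simp: generic_def)
  define l where "l = (\<lambda>t::real. a + t *\<^sub>R (b - a))"
  have l: "polynomial_function l"
    unfolding l_def
    by (intro polynomial_function_add polynomial_function_const polynomial_function_mult
        polynomial_function_bounded_linear) (auto intro: bounded_linear_intros)
  have fin: "finite {t. k (l t) = 0}" if k: "real_polynomial_function k" and "k (l t0) \<noteq> 0" for k t0
  proof -
    have "real_polynomial_function (k \<circ> l)"
      using real_polynomial_function_compose[OF l k] .
    then obtain c m where c: "k \<circ> l = (\<lambda>x. \<Sum>i\<le>m. c i * x ^ i)"
      using real_polynomial_function_imp_sum by blast
    then have e: "k (l t) = (\<Sum>i\<le>m. c i * t ^ i)" for t by (metis comp_apply)
    have "\<exists>i\<le>m. c i \<noteq> 0" using that(2) unfolding e by (metis (no_types, lifting) atMost_iff mult_zero_left sum.neutral)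
    then show ?thesis using polyfun_finite_roots[of c m] by (simp add: e)
  qed
  have "finite {t. f (l t) = 0}" by (rule fin[of f 0]) (use f in \<open>auto simp: l_def\<close>)
  moreover have "finite {t. g (l t) = 0}" by (rule fin[of g 1]) (use g in \<open>auto simp: l_def\<close>)
  ultimately obtain t where "t \<notin> {t. f (l t) = 0} \<union> {t. g (l t) = 0}"
    using ex_new_if_finite[OF infinite_UNIV_char_0] by (metis finite_Un)
  then have "f (l t) * g (l t) \<noteq> 0" by simp
  then show ?thesis
    by (intro generic_polynomial[of "\<lambda>h. f h * g h"]) (use f g in auto)
qed

lemma generic_ball:
  assumes "finite A" "\<And>a. a \<in> A \<Longrightarrow> generic (P a)"
  shows "generic (\<lambda>h. \<forall>a\<in>A. P a h)"
  using assms by (induction A rule: finite_induct) (auto intro: generic_True generic_conj)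

text \<open>The Gram determinant is a polynomial in \<open>h\<close> that vanishes exactly when the
  rows are dependent. Padding the Gram matrix by an identity block outside \<open>I\<close> lets it
  range over the whole index type.\<close>

lemma generic_indep_family:
  fixes r :: "'e::finite \<Rightarrow> 'h::real_normed_vector \<Rightarrow> 'a::real_inner"
  assumes poly: "\<And>a b. real_polynomial_function (\<lambda>h. r a h \<bullet> r b h)"
    and ex: "indep_family I (\<lambda>e. r e h0)"
  shows "generic (\<lambda>h. indep_family I (\<lambda>e. r e h))"
proof -
  define G :: "'h \<Rightarrow> real^'e^'e" where
    "G h = (\<chi> a b. if a \<in> I \<and> b \<in> I then r a h \<bullet> r b h else if a = b then 1 else 0)" for h
  have Gv: "(G h *v c) $ a = (if a \<in> I then r a h \<bullet> (\<Sum>b\<in>I. c $ b *\<^sub>R r b h) else c $ a)" for h c a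
  proof (cases "a \<in> I")
    case True
    have "(G h *v c) $ a = (\<Sum>b\<in>UNIV. (if b \<in> I then (r a h \<bullet> r b h) * c $ b else 0))"
      unfolding G_def matrix_vector_mult_def using True by (auto intro!: sum.cong)
    also have "\<dots> = (\<Sum>b\<in>I. (r a h \<bullet> r b h) * c $ b)"
      by (simp add: sum.If_cases)
    also have "\<dots> = r a h \<bullet> (\<Sum>b\<in>I. c $ b *\<^sub>R r b h)"
      by (simp add: inner_sum_right mult.commute)
    finally show ?thesis using True by simp
  next
    case False
    then show ?thesis
      by (simp add: G_def matrix_vector_mult_def if_distrib[of "\<lambda>x. x * _"] cong: if_cong)
  qed
  have iff: "det (G h) \<noteq> 0 \<longleftrightarrow> indep_family I (\<lambda>e. r e h)" for h
  proof -
    have "det (G h) \<noteq> 0 \<longleftrightarrow> inj ((*v) (G h))"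
      using det_nz_iff_inj[of "(*v) (G h)"] by (simp add: matrix_vector_mul_linear)
    also have "\<dots> \<longleftrightarrow> (\<forall>c. G h *v c = 0 \<longrightarrow> c = 0)"
      by (simp add: linear_injective_0 matrix_vector_mul_linear)
    also have "\<dots> \<longleftrightarrow> indep_family I (\<lambda>e. r e h)"
    proof
      assume L: "\<forall>c. G h *v c = 0 \<longrightarrow> c = 0"
      show "indep_family I (\<lambda>e. r e h)" unfolding indep_family_def
      proof (intro allI impI ballI)
        fix c e assume c: "(\<Sum>e\<in>I. c e *\<^sub>R r e h) = 0" and e: "e \<in> I"
        have "G h *v (\<chi> e. if e \<in> I then c e else 0) = 0"
          unfolding vec_eq_iff Gv using c by simp
        then have "(\<chi> e. if e \<in> I then c e else 0) = (0::real^'e)" using L by blast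
        then show "c e = 0" using e by (simp add: vec_eq_iff) metis
      qed
    next
      assume ind: "indep_family I (\<lambda>e. r e h)"
      show "\<forall>c. G h *v c = 0 \<longrightarrow> c = 0"
      proof (intro allI impI)
        fix c :: "real^'e" assume c: "G h *v c = 0"
        define s where "s = (\<Sum>b\<in>I. c $ b *\<^sub>R r b h)"
        have g: "(if a \<in> I then r a h \<bullet> s else c $ a) = 0" for a
          unfolding s_def Gv[symmetric] using c by simp
        \<comment> \<open>A kernel vector of the Gram matrix gives a combination \<open>s\<close>
          orthogonal to every row, hence to itself.\<close>
        have "s \<bullet> s = (\<Sum>b\<in>I. c $ b * (r b h \<bullet> s))"
          by (simp add: s_def inner_sum_left)
        also have "\<dots> = 0" using g by (intro sum.neutral) (metis mult_zero_right)
        finally have "s = 0" by simp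
        then have "\<And>a. a \<in> I \<Longrightarrow> c $ a = 0"
          using indep_familyD[OF ind, of "\<lambda>e. c $ e"] by (simp add: s_def)
        with g have "c $ a = 0" for a by metis
        then show "c = 0" by (simp add: vec_eq_iff)
      qed
    qed
    finally show ?thesis .
  qed
  have "real_polynomial_function (\<lambda>h. G h $ a $ b)" for a b
    using poly[of a b] by (cases "a \<in> I \<and> b \<in> I") (auto simp: G_def)
  then have "real_polynomial_function (\<lambda>h. det (G h))"
    unfolding det_def
    by (intro real_polynomial_function_sum real_polynomial_function.intros(4)
        real_polynomial_function.intros(2) real_polynomial_function_prod) auto
  then show ?thesis
    by (rule generic_polynomial[of _ h0]) (use ex in \<open>auto simp: iff\<close>)
qed

section \<open>Generic hyperplane sections\<close>

text \<open>
  The vector spanned by \<open>(\<alpha> e, 0)\<close> and \<open>(0, \<beta> e)\<close> in the hyperplane orthogonal to \<open>h\<close>.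
\<close>

definition truncated_row ::
    "('e \<Rightarrow> 'a::real_inner) \<Rightarrow> ('e \<Rightarrow> 'b::real_inner) \<Rightarrow> 'e \<Rightarrow> 'a \<times> 'b \<Rightarrow> 'a \<times> 'b" where
  "truncated_row \<alpha> \<beta> e h = (- (\<beta> e \<bullet> snd h) *\<^sub>R \<alpha> e, (\<alpha> e \<bullet> fst h) *\<^sub>R \<beta> e)"

text \<open>The pairing is the alternating form \<open>(\<alpha> e \<bullet> fst h) * (\<beta> e
  \<bullet> snd k) - (\<beta> e \<bullet> snd h) * (\<alpha> e \<bullet> fst k)\<close> in
  \<open>h\<close> and \<open>k\<close>.\<close>

lemma truncated_row_skew: "k \<bullet> truncated_row \<alpha> \<beta> e h = - (h \<bullet> truncated_row \<alpha> \<beta> e k)"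
  by (simp add: truncated_row_def inner_prod_def inner_commute)

lemma truncated_row_affine:
  "truncated_row \<alpha> \<beta> e (h + t *\<^sub>R k) = truncated_row \<alpha> \<beta> e h + t *\<^sub>R truncated_row \<alpha> \<beta> e k"
  by (simp add: truncated_row_def inner_add_right scaleR_add_left algebra_simps)

lemma truncated_row_inner_polynomial:
  fixes \<alpha> :: "'e \<Rightarrow> 'a::real_inner" and \<beta> :: "'e \<Rightarrow> 'b::real_inner"
  shows "real_polynomial_function (\<lambda>h. truncated_row \<alpha> \<beta> e h \<bullet> truncated_row \<alpha> \<beta> f h)"
proof -
  have "real_polynomial_function (\<lambda>h::'a \<times> 'b. \<alpha> e \<bullet> fst h)"
    "real_polynomial_function (\<lambda>h::'a \<times> 'b. \<beta> e \<bullet> snd h)" for e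
    by (auto intro!: real_polynomial_function.intros(1) bounded_linear_inner_right_comp
        bounded_linear_fst bounded_linear_snd)
  then show ?thesis
    unfolding truncated_row_def inner_prod_def fst_conv snd_conv inner_scaleR_left inner_scaleR_right
    by (intro real_polynomial_function.intros(2-4) real_polynomial_function_minus)
qed

text \<open>Orthogonality says that the pairs
  \<open>(\<alpha> e \<bullet> fst _, \<beta> e \<bullet> snd _)\<close> taken at \<open>h\<close>
  and at \<open>k\<close> have determinant zero. The pair at \<open>h\<close> is nonzero because the
  row is, so the pair at \<open>k\<close> is a multiple of it.\<close>

lemma truncated_row_parallel:
  assumes "k \<bullet> truncated_row \<alpha> \<beta> e h = 0" "truncated_row \<alpha> \<beta> e h \<noteq> 0"
  obtains c where "\<alpha> e \<bullet> fst k = c * (\<alpha> e \<bullet> fst h)" "\<beta> e \<bullet> snd k = c * (\<beta> e \<bullet> snd h)"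
    "truncated_row \<alpha> \<beta> e k = c *\<^sub>R truncated_row \<alpha> \<beta> e h"
proof -
  have eq: "(\<beta> e \<bullet> snd h) * (\<alpha> e \<bullet> fst k) = (\<alpha> e \<bullet> fst h) * (\<beta> e \<bullet> snd k)"
    using assms(1) by (simp add: truncated_row_def inner_prod_def inner_commute)
  have "\<alpha> e \<bullet> fst h \<noteq> 0 \<or> \<beta> e \<bullet> snd h \<noteq> 0"
    using assms(2) by (auto simp: truncated_row_def zero_prod_def)
  then obtain c where c: "\<alpha> e \<bullet> fst k = c * (\<alpha> e \<bullet> fst h)" "\<beta> e \<bullet> snd k = c * (\<beta> e \<bullet> snd h)"
  proof
    assume "\<alpha> e \<bullet> fst h \<noteq> 0"
    then show thesis using eq that[of "(\<alpha> e \<bullet> fst k) / (\<alpha> e \<bullet> fst h)"] by (simp add: field_simps)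
  next
    assume "\<beta> e \<bullet> snd h \<noteq> 0"
    then show thesis using eq that[of "(\<beta> e \<bullet> snd k) / (\<beta> e \<bullet> snd h)"] by (simp add: field_simps)
  qed
  moreover have "truncated_row \<alpha> \<beta> e k = c *\<^sub>R truncated_row \<alpha> \<beta> e h"
    using c by (simp add: truncated_row_def)
  ultimately show thesis using that by blast
qed

text \<open>
  Rows that are dependent at every point are dependent along the line \<open>h + t z\<close>. Pairing the dependency with
  \<open>k\<close> kills the terms at \<open>h\<close>; after division by \<open>t\<close>, letting \<open>t\<close> tend to 0 recovers the unique
  dependency at \<open>h\<close>.
\<close>

lemma truncation_stress_of_motion:
  fixes \<alpha> :: "'e::finite \<Rightarrow> 'a::euclidean_space" and \<beta> :: "'e \<Rightarrow> 'b::euclidean_space"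
  assumes dep: "\<And>h. \<not> indep_family C (\<lambda>e. truncated_row \<alpha> \<beta> e h)"
    and unique: "\<And>\<mu>. (\<Sum>e\<in>C. \<mu> e *\<^sub>R truncated_row \<alpha> \<beta> e h) = 0 \<Longrightarrow> \<exists>c. \<forall>e\<in>C. \<mu> e = c * \<kappa> e"
    and k: "\<And>e. e \<in> C \<Longrightarrow> k \<bullet> truncated_row \<alpha> \<beta> e h = 0"
  shows "(\<Sum>e\<in>C. \<kappa> e *\<^sub>R truncated_row \<alpha> \<beta> e k) = 0"
proof -
  let ?w = "truncated_row \<alpha> \<beta>"
  have "z \<bullet> (\<Sum>e\<in>C. \<kappa> e *\<^sub>R ?w e k) = 0" for z
  proof -
    define t where "t n = 1 / real (Suc n)" for n
    have "\<exists>\<mu> :: real^'e. norm \<mu> = 1 \<and> (\<forall>e. e \<notin> C \<longrightarrow> \<mu> $ e = 0) \<and>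
        (\<Sum>e\<in>C. \<mu> $ e *\<^sub>R ?w e (h + t n *\<^sub>R z)) = 0" for n
      using not_indep_family_unit[OF dep, of "h + t n *\<^sub>R z"] by metis
    then obtain \<mu> :: "nat \<Rightarrow> real^'e" where \<mu>: "\<And>n. norm (\<mu> n) = 1"
      "\<And>n e. e \<notin> C \<Longrightarrow> \<mu> n $ e = 0"
      "\<And>n. (\<Sum>e\<in>C. \<mu> n $ e *\<^sub>R ?w e (h + t n *\<^sub>R z)) = 0"
      by metis
    \<comment> \<open>Unit norm keeps the dependencies from collapsing: their limit \<open>l\<close>
      is a nonzero dependency at \<open>h\<close>, hence a nonzero multiple of
      \<open>\<kappa>\<close>.\<close>
    have "compact (sphere (0::real^'e) 1)" by simp
    then obtain l s where s: "strict_mono s" "l \<in> sphere 0 1" "(\<mu> \<circ> s) \<longlonglongrightarrow> l"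
      unfolding compact_def using \<mu>(1) by (metis dist_0_norm mem_sphere)
    have lim: "(\<lambda>n. \<mu> (s n) $ e) \<longlonglongrightarrow> l $ e" for e
      using tendsto_vec_nth[OF s(3)] by (simp add: o_def)
    have tlim: "(\<lambda>n. t (s n)) \<longlonglongrightarrow> 0"
      using LIMSEQ_subseq_LIMSEQ[OF LIMSEQ_inverse_real_of_nat s(1)]
      by (simp add: o_def t_def inverse_eq_divide)
    have "(\<lambda>n. \<Sum>e\<in>C. \<mu> (s n) $ e *\<^sub>R (?w e h + t (s n) *\<^sub>R ?w e z))
        \<longlonglongrightarrow> (\<Sum>e\<in>C. l $ e *\<^sub>R (?w e h + 0 *\<^sub>R ?w e z))"
      by (intro tendsto_intros lim tlim)
    then have l0: "(\<Sum>e\<in>C. l $ e *\<^sub>R ?w e h) = 0"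
      using \<mu>(3) by (simp add: truncated_row_affine LIMSEQ_const_iff)
    have kz: "(\<Sum>e\<in>C. \<mu> n $ e * (k \<bullet> ?w e z)) = 0" for n
    proof -
      have "0 = k \<bullet> (\<Sum>e\<in>C. \<mu> n $ e *\<^sub>R ?w e (h + t n *\<^sub>R z))" using \<mu>(3) by simp
      also have "\<dots> = t n * (\<Sum>e\<in>C. \<mu> n $ e * (k \<bullet> ?w e z))"
        by (simp add: truncated_row_affine inner_sum_right inner_add_right k sum_distrib_left mult_ac)
      finally show ?thesis by (simp add: t_def)
    qed
    have "(\<lambda>n. \<Sum>e\<in>C. \<mu> (s n) $ e * (k \<bullet> ?w e z)) \<longlonglongrightarrow> (\<Sum>e\<in>C. l $ e * (k \<bullet> ?w e z))"
      by (intro tendsto_intros lim)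
    then have lkz: "(\<Sum>e\<in>C. l $ e * (k \<bullet> ?w e z)) = 0"
      using kz by (simp add: LIMSEQ_const_iff)
    obtain c where c: "\<And>e. e \<in> C \<Longrightarrow> l $ e = c * \<kappa> e" using unique[OF l0] by blast
    have "c \<noteq> 0"
    proof
      assume "c = 0"
      have "l $ e = 0" for e
      proof (cases "e \<in> C")
        case True then show ?thesis using c \<open>c = 0\<close> by simp
      next
        case False
        then have "(\<lambda>n. \<mu> (s n) $ e) = (\<lambda>n. 0)" using \<mu>(2) by simp
        then show ?thesis using lim[of e] by (simp add: LIMSEQ_const_iff)
      qed
      then have "l = 0" by (simp add: vec_eq_iff)
      with s(2) show False by simp
    qed
    have "c * (\<Sum>e\<in>C. \<kappa> e * (k \<bullet> ?w e z)) = 0"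
      using lkz c by (simp add: sum_distrib_left mult.assoc)
    then have "(\<Sum>e\<in>C. \<kappa> e * (k \<bullet> ?w e z)) = 0" using \<open>c \<noteq> 0\<close> by simp
    moreover have "z \<bullet> (\<Sum>e\<in>C. \<kappa> e *\<^sub>R ?w e k) = - (\<Sum>e\<in>C. \<kappa> e * (k \<bullet> ?w e z))"
      by (simp add: inner_sum_right truncated_row_skew[of z] sum_negf)
    ultimately show ?thesis by simp
  qed
  then show ?thesis by (metis inner_eq_zero_iff)
qed

text \<open>
  Lovasz's theorem on generic hyperplane sections of lines and planes. For a minimal
  set \<open>C\<close> that is dependent at every \<open>h\<close>, take \<open>h\<close> generic. A vector \<open>k\<close> orthogonal to the rows at \<open>h\<close>
  has rows \<open>c e\<close> times those of \<open>h\<close> and the same dependency, so uniqueness makes \<open>c\<close> constant on \<open>C\<close>.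
  Hence the rows span the whole hyperplane section, and \<open>C\<close> violates the count.
\<close>

lemma dilworth_truncation:
  fixes \<alpha> :: "'e::finite \<Rightarrow> 'a::euclidean_space" and \<beta> :: "'e \<Rightarrow> 'b::euclidean_space"
  assumes count: "\<And>F. F \<subseteq> I \<Longrightarrow> F \<noteq> {} \<Longrightarrow> card F + 1 \<le> dim (\<alpha> ` F) + dim (\<beta> ` F)"
  shows "\<exists>h. indep_family I (\<lambda>e. truncated_row \<alpha> \<beta> e h)"
proof (rule ccontr)
  let ?w = "truncated_row \<alpha> \<beta>"
  let ?dep = "\<lambda>C. C \<subseteq> I \<and> (\<forall>h. \<not> indep_family C (\<lambda>e. ?w e h))"
  assume "\<nexists>h. indep_family I (\<lambda>e. ?w e h)"
  then have "?dep I" by blast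
  then obtain C where C: "?dep C" and min: "\<And>D. ?dep D \<Longrightarrow> card C \<le> card D"
    using arg_min_nat_lemma[of ?dep I card] by blast
  then have CI: "C \<subseteq> I" and dep: "\<And>h. \<not> indep_family C (\<lambda>e. ?w e h)" by auto
  have Cne: "C \<noteq> {}" using dep by (auto simp: indep_family_def)
  \<comment> \<open>Minimality makes each deletion \<open>C - {e}\<close> independent at some point;
    genericity provides one point that serves all deletions at once.\<close>
  have "generic (\<lambda>h. \<forall>e\<in>C. indep_family (C - {e}) (\<lambda>e. ?w e h))"
  proof (rule generic_ball)
    fix e assume e: "e \<in> C"
    then have "card (C - {e}) < card C" by (simp add: card_gt_0_iff Cne)
    then obtain h where "indep_family (C - {e}) (\<lambda>e. ?w e h)"
      using min[of "C - {e}"] CI by force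
    then show "generic (\<lambda>h. indep_family (C - {e}) (\<lambda>e. ?w e h))"
      by (rule generic_indep_family[rotated]) (rule truncated_row_inner_polynomial)
  qed simp
  then obtain h where h: "\<And>e. e \<in> C \<Longrightarrow> indep_family (C - {e}) (\<lambda>e. ?w e h)"
    using generic_ex by blast
  obtain l where l: "(\<Sum>e\<in>C. l e *\<^sub>R ?w e h) = 0" and l0: "\<exists>e\<in>C. l e \<noteq> 0"
    using dep[of h] by (auto simp: indep_family_def)
  have vanish: "\<forall>e\<in>C. \<mu> e = 0" if "(\<Sum>e\<in>C. \<mu> e *\<^sub>R ?w e h) = 0" "e0 \<in> C" "\<mu> e0 = 0" for \<mu> e0
  proof -
    have "(\<Sum>e\<in>C - {e0}. \<mu> e *\<^sub>R ?w e h) = 0"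
      using that by (simp add: sum_diff1)
    then show ?thesis using indep_familyD[OF h[OF that(2)]] that(3) by (metis Diff_iff singletonD)
  qed
  have lnz: "l e \<noteq> 0" if "e \<in> C" for e
    using vanish[OF l that] l0 by blast
  have unique: "\<exists>c. \<forall>e\<in>C. \<mu> e = c * l e" if \<mu>: "(\<Sum>e\<in>C. \<mu> e *\<^sub>R ?w e h) = 0" for \<mu>
  proof -
    obtain e0 where e0: "e0 \<in> C" using Cne by blast
    let ?c = "\<mu> e0 / l e0"
    have "(\<Sum>e\<in>C. (\<mu> e - ?c * l e) *\<^sub>R ?w e h) =
        (\<Sum>e\<in>C. \<mu> e *\<^sub>R ?w e h) - ?c *\<^sub>R (\<Sum>e\<in>C. l e *\<^sub>R ?w e h)"
      by (simp add: scaleR_diff_left sum_subtractf scaleR_right.sum)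
    then have "(\<Sum>e\<in>C. (\<mu> e - ?c * l e) *\<^sub>R ?w e h) = 0" using l \<mu> by simp
    from vanish[OF this e0] lnz[OF e0] show ?thesis by (intro exI[of _ ?c]) simp
  qed
  have wnz: "?w e h \<noteq> 0" if e: "e \<in> C" for e
  proof
    assume w0: "?w e h = 0"
    \<comment> \<open>A zero row is a dependency by itself, so minimality leaves only
      \<open>e\<close>. The count for \<open>{e}\<close> then makes \<open>\<alpha> e\<close> and
      \<open>\<beta> e\<close> nonzero, and the point \<open>(\<alpha> e, 0)\<close> gives a nonzero
      row.\<close>
    have "C = {e}"
    proof (rule ccontr)
      assume "C \<noteq> {e}"
      then obtain f where f: "f \<in> C" "f \<noteq> e" using e by blast
      have "(\<Sum>d\<in>C - {f}. (if d = e then 1 else 0) *\<^sub>R ?w d h) = 0"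
        by (intro sum.neutral) (use w0 in auto)
      from indep_familyD[OF h[OF f(1)] this, of e] e f show False by simp
    qed
    have nz: "\<alpha> e \<noteq> 0" "\<beta> e \<noteq> 0"
      using count[of "{e}"] e CI by (auto simp: dim_insert split: if_splits)
    have "indep_family C (\<lambda>d. ?w d (\<alpha> e, 0))"
      unfolding indep_family_def \<open>C = {e}\<close> using nz by (simp add: truncated_row_def zero_prod_def)
    then show False using dep by blast
  qed
  have motion: "\<exists>c. \<forall>e\<in>C. \<alpha> e \<bullet> (fst k - c *\<^sub>R fst h) = 0 \<and> \<beta> e \<bullet> (snd k - c *\<^sub>R snd h) = 0"
    if k: "\<And>e. e \<in> C \<Longrightarrow> k \<bullet> ?w e h = 0" for k
  proof -
    have "\<forall>e\<in>C. \<exists>c. \<alpha> e \<bullet> fst k = c * (\<alpha> e \<bullet> fst h) \<and> \<beta> e \<bullet> snd k = c * (\<beta> e \<bullet> snd h) \<and>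
        ?w e k = c *\<^sub>R ?w e h"
      using truncated_row_parallel[OF k wnz] by metis
    then obtain c where c: "\<And>e. e \<in> C \<Longrightarrow> \<alpha> e \<bullet> fst k = c e * (\<alpha> e \<bullet> fst h) \<and>
        \<beta> e \<bullet> snd k = c e * (\<beta> e \<bullet> snd h) \<and> ?w e k = c e *\<^sub>R ?w e h"
      by metis
    have "(\<Sum>e\<in>C. l e *\<^sub>R ?w e k) = 0"
      by (rule truncation_stress_of_motion[OF dep unique k])
    then have "(\<Sum>e\<in>C. (l e * c e) *\<^sub>R ?w e h) = 0" using c by simp
    then obtain b where "\<And>e. e \<in> C \<Longrightarrow> l e * c e = b * l e"
      using unique[of "\<lambda>e. l e * c e"] by blast
    then have "c e = b" if "e \<in> C" for e using lnz[OF that] that by force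
    then show ?thesis using c by (intro exI[of _ b]) (simp add: inner_diff_right)
  qed
  define U where "U = span (\<alpha> ` C) \<times> span (\<beta> ` C)"
  define L where "L = span ((\<lambda>e. ?w e h) ` C)"
  have dimU: "dim U = dim (\<alpha> ` C) + dim (\<beta> ` C)"
    unfolding U_def by (simp add: dim_Times)
  have subU: "subspace U" unfolding U_def by (intro subspace_Times subspace_span)
  have "?w e h \<in> U" if "e \<in> C" for e
    using that unfolding U_def truncated_row_def mem_Times_iff fst_conv snd_conv
    by (intro conjI span_scale span_base) auto
  then have LU: "L \<subseteq> U" unfolding L_def using subU by (intro span_minimal) auto
  have dimL: "dim L + 1 \<le> card C"
  proof -
    obtain e where e: "e \<in> C" using Cne by blast
    have "?w e h = - (\<Sum>d\<in>C - {e}. (l d / l e) *\<^sub>R ?w d h)"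
    proof -
      have "l e *\<^sub>R ?w e h + (\<Sum>d\<in>C - {e}. l d *\<^sub>R ?w d h) = 0"
        using l e by (simp add: sum.remove)
      then have "l e *\<^sub>R ?w e h = - (\<Sum>d\<in>C - {e}. l d *\<^sub>R ?w d h)"
        by (simp add: eq_neg_iff_add_eq_0)
      then have "(1 / l e) *\<^sub>R (l e *\<^sub>R ?w e h) = - ((1 / l e) *\<^sub>R (\<Sum>d\<in>C - {e}. l d *\<^sub>R ?w d h))"
        by simp
      then show ?thesis using lnz[OF e] by (simp add: scaleR_right.sum)
    qed
    also have "\<dots> \<in> span ((\<lambda>e. ?w e h) ` (C - {e}))"
      by (intro span_neg span_sum span_scale span_base) auto
    finally have "(\<lambda>e. ?w e h) ` C \<subseteq> span ((\<lambda>e. ?w e h) ` (C - {e}))"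
      by (metis (no_types, lifting) Diff_iff image_eqI image_subsetI singletonD span_base)
    then have "L \<subseteq> span ((\<lambda>e. ?w e h) ` (C - {e}))"
      unfolding L_def by (intro span_minimal) auto
    then have "dim L \<le> card ((\<lambda>e. ?w e h) ` (C - {e}))"
      by (intro dim_le_card) auto
    also have "\<dots> \<le> card (C - {e})" by (intro card_image_le) auto
    also have "\<dots> < card C" using e by (simp add: card_gt_0_iff Cne)
    finally show ?thesis by simp
  qed
  \<comment> \<open>By \<open>motion\<close>, a member of \<open>?M\<close> has the same pairings
    with \<open>U\<close> as some multiple of \<open>h\<close>, so it is a multiple of the
    projection of \<open>h\<close> to \<open>U\<close>.\<close>
  let ?M = "{y \<in> U. \<forall>x\<in>L. orthogonal x y}"
  have "dim ?M \<le> 1"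
  proof (rule dim_le_1_if_proportional)
    have M: "\<exists>c. \<forall>u\<in>U. (k - c *\<^sub>R h) \<bullet> u = 0" if k: "k \<in> ?M" for k
    proof -
      have "k \<bullet> ?w e h = 0" if "e \<in> C" for e
      proof -
        have "?w e h \<in> L" unfolding L_def using that by (intro span_base) auto
        then show ?thesis using k by (auto simp: orthogonal_def inner_commute)
      qed
      then obtain c where c: "\<And>e. e \<in> C \<Longrightarrow> \<alpha> e \<bullet> (fst k - c *\<^sub>R fst h) = 0"
        "\<And>e. e \<in> C \<Longrightarrow> \<beta> e \<bullet> (snd k - c *\<^sub>R snd h) = 0"
        using motion[of k] by blast
      have a: "(fst k - c *\<^sub>R fst h) \<bullet> u = 0" if "u \<in> span (\<alpha> ` C)" for u
        using that by (induction rule: span_induct)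
          (auto simp: c inner_commute subspace_def inner_add_left)
      have b: "(snd k - c *\<^sub>R snd h) \<bullet> u = 0" if "u \<in> span (\<beta> ` C)" for u
        using that by (induction rule: span_induct)
          (auto simp: c inner_commute subspace_def inner_add_left)
      have "\<forall>u\<in>U. (k - c *\<^sub>R h) \<bullet> u = 0"
        using a b by (auto simp: U_def inner_prod_def)
      then show ?thesis by blast
    qed
    fix x y assume x: "x \<in> ?M" "x \<noteq> 0" and y: "y \<in> ?M"
    obtain c where c: "\<forall>u\<in>U. (x - c *\<^sub>R h) \<bullet> u = 0" using M[OF x(1)] by blast
    obtain d where d: "\<forall>u\<in>U. (y - d *\<^sub>R h) \<bullet> u = 0" using M[OF y] by blast
    have "c \<noteq> 0" using c x by fastforce
    define z where "z = y - (d / c) *\<^sub>R x"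
    have zU: "z \<in> U" unfolding z_def using x y subU by (auto intro: subspace_diff subspace_scale)
    have "z = (y - d *\<^sub>R h) - (d / c) *\<^sub>R (x - c *\<^sub>R h)"
      using \<open>c \<noteq> 0\<close> by (simp add: z_def algebra_simps)
    then have "z \<bullet> z = (y - d *\<^sub>R h) \<bullet> z - (d / c) * ((x - c *\<^sub>R h) \<bullet> z)"
      by (metis inner_diff_left inner_scaleR_left)
    then have "z \<bullet> z = 0" using c d zU by simp
    then show "\<exists>c. y = c *\<^sub>R x" by (auto simp: z_def)
  qed
  moreover have "dim ?M + dim L = dim U"
    by (rule dim_subspace_orthogonal_to_vectors) (use subU LU in \<open>auto simp: L_def\<close>)
  \<comment> \<open>Here \<open>dim U\<close> is at most \<open>(card C - 1) + 1\<close>, one less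
    than the count requires.\<close>
  ultimately show False
    using count[OF CI Cne] dimU dimL by linarith
qed

section \<open>Gain graphs and signed incidence vectors\<close>

definition step_gain :: "('e \<Rightarrow> 'g::group_add) \<Rightarrow> 'e \<times> bool \<Rightarrow> 'g" where
  "step_gain \<psi> s = (if snd s then \<psi> (fst s) else - \<psi> (fst s))"

lemma cycle_gain_eq: "cycle_gain \<psi> c = sum_list (map (step_gain \<psi>) c)"
  unfolding cycle_gain_def by (rule arg_cong[where f = sum_list]) (auto simp: step_gain_def)

lemma gain_cycle_iff:
  "gain_cycle H c \<longleftrightarrow> c \<noteq> [] \<and> fst ` set c \<subseteq> arcs H \<and> distinct (map fst c) \<and>
     distinct (map (start_vertex H) c) \<and>
     successively (\<lambda>s t. end_vertex H s = start_vertex H t) c \<and>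
     end_vertex H (last c) = start_vertex H (hd c)"
  unfolding gain_cycle_def successively_conv_nth by auto

text \<open>A potential records the switching at the vertices that makes all gains on
  \<open>F\<close> trivial.\<close>

definition gain_potential ::
    "('w, 'e) pre_digraph \<Rightarrow> ('e \<Rightarrow> 'g::ab_group_add) \<Rightarrow> 'e set \<Rightarrow> ('w \<Rightarrow> 'g) \<Rightarrow> bool" where
  "gain_potential H \<psi> F \<sigma> \<longleftrightarrow> (\<forall>a\<in>F. \<psi> a = \<sigma> (tail H a) - \<sigma> (head H a))"

lemma walk_gain_telescope:
  assumes "gain_potential H \<psi> F \<sigma>" "fst ` set c \<subseteq> F" "c \<noteq> []"
    "successively (\<lambda>s t. end_vertex H s = start_vertex H t) c"
  shows "cycle_gain \<psi> c = \<sigma> (start_vertex H (hd c)) - \<sigma> (end_vertex H (last c))"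
  using assms(2-4)
proof (induction c)
  case (Cons s c)
  have s: "step_gain \<psi> s = \<sigma> (start_vertex H s) - \<sigma> (end_vertex H s)"
    using Cons.prems(1) assms(1)
    by (auto simp: step_gain_def gain_potential_def start_vertex_def end_vertex_def)
  show ?case
  proof (cases "c = []")
    case True then show ?thesis using s by (simp add: cycle_gain_eq)
  next
    case False
    then show ?thesis using Cons s by (simp add: cycle_gain_eq successively_Cons)
  qed
qed simp

text \<open>Paths instead of arbitrary walks: adding the closing arc must produce a
  \<open>gain_cycle\<close>, whose arcs and start vertices are distinct.\<close>

definition simple_walk :: "('w, 'e) pre_digraph \<Rightarrow> 'e set \<Rightarrow> 'w \<Rightarrow> ('e \<times> bool) list \<Rightarrow> 'w \<Rightarrow> bool" where
  "simple_walk H F u c v \<longleftrightarrow> fst ` set c \<subseteq> F \<and> distinct (map fst c) \<and>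
     distinct (map (start_vertex H) c @ [v]) \<and>
     successively (\<lambda>s t. end_vertex H s = start_vertex H t) c \<and>
     (if c = [] then u = v else start_vertex H (hd c) = u \<and> end_vertex H (last c) = v)"

lemma successively_end_mem:
  assumes "successively (\<lambda>s t. end_vertex H s = start_vertex H t) c" "s \<in> set c"
  shows "end_vertex H s \<in> start_vertex H ` set c \<union> {end_vertex H (last c)}"
  using assms
proof (induction c)
  case (Cons t c) then show ?case by (cases c) auto
qed simp

text \<open>If the new end vertex was visited before, the path is cut off there. Otherwise the step
  is appended; its arc is new, since both ends of a used arc have been visited.\<close>

lemma simple_walk_extend:
  assumes c: "simple_walk H F u c (start_vertex H s)" and s: "fst s \<in> F"
  shows "\<exists>c. simple_walk H F u c (end_vertex H s)"
proof -
  let ?v = "start_vertex H s" and ?w = "end_vertex H s"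
  consider "?w = ?v" | "?w \<in> start_vertex H ` set c" | "?w \<noteq> ?v" "?w \<notin> start_vertex H ` set c"
    by blast
  then show ?thesis
  proof cases
    case 1 then show ?thesis using c by auto
  next
    case 2
    then obtain t c1 c2 where t: "c = c1 @ t # c2" "start_vertex H t = ?w"
      by (metis imageE split_list)
    have "simple_walk H F u c1 ?w"
      using c t by (auto simp: simple_walk_def successively_append_iff split: if_splits)
    then show ?thesis by blast
  next
    case 3
    have "fst s \<notin> fst ` set c"
    proof
      assume "fst s \<in> fst ` set c"
      then obtain t where t: "t \<in> set c" "fst t = fst s" by auto
      then have "?w = start_vertex H t \<or> ?w = end_vertex H t"
        by (auto simp: start_vertex_def end_vertex_def)
      moreover have "end_vertex H t \<in> start_vertex H ` set c \<union> {?v}"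
        using successively_end_mem[of H c t] c t(1) by (auto simp: simple_walk_def split: if_splits)
      ultimately show False using 3 t(1) by auto
    qed
    then have "simple_walk H F u (c @ [s]) ?w"
      using c s 3 by (auto simp: simple_walk_def successively_append_iff split: if_splits)
    then show ?thesis by blast
  qed
qed

text \<open>Gains of a potential telescope to zero around cycles. Conversely a potential is built
  arc by arc: if the head of the new arc is reachable from its tail, the cycle so closed is balanced
  and the old potential works; if not, the component of the tail can be shifted.\<close>

lemma balanced_iff_potential:
  fixes \<psi> :: "'e \<Rightarrow> 'g::ab_group_add"
  assumes "finite F" "F \<subseteq> arcs H"
  shows "balanced H \<psi> F \<longleftrightarrow> (\<exists>\<sigma>. gain_potential H \<psi> F \<sigma>)"
proof
  assume "\<exists>\<sigma>. gain_potential H \<psi> F \<sigma>"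
  then show "balanced H \<psi> F"
    by (auto simp: balanced_def gain_cycle_iff walk_gain_telescope)
next
  show "balanced H \<psi> F \<Longrightarrow> \<exists>\<sigma>. gain_potential H \<psi> F \<sigma>"
    using assms
  proof (induction F rule: finite_induct)
    case empty then show ?case by (simp add: gain_potential_def)
  next
    case (insert a F)
    have "balanced H \<psi> F" using insert.prems(1) unfolding balanced_def by blast
    with insert obtain \<sigma> where \<sigma>: "gain_potential H \<psi> F \<sigma>" by auto
    define C where "C = {w. \<exists>c. simple_walk H F (tail H a) c w}"
    have tC: "tail H a \<in> C"
      unfolding C_def by (auto intro!: exI[of _ "[]"] simp: simple_walk_def)
    have closed: "tail H b \<in> C \<longleftrightarrow> head H b \<in> C" if "b \<in> F" for b
      using simple_walk_extend[of H F "tail H a" _ "(b, True)"]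
        simple_walk_extend[of H F "tail H a" _ "(b, False)"] that
      by (auto simp: C_def start_vertex_def end_vertex_def)
    show ?case
    proof (cases "head H a \<in> C")
      case True
      then obtain c where c: "simple_walk H F (tail H a) c (head H a)" by (auto simp: C_def)
      let ?s = "(a, False)"
      have "gain_cycle H (c @ [?s])"
        using c insert.hyps insert.prems
        by (auto simp: gain_cycle_iff simple_walk_def successively_append_iff start_vertex_def
            end_vertex_def hd_append split: if_splits)
      moreover have "fst ` set (c @ [?s]) \<subseteq> insert a F"
        using c by (auto simp: simple_walk_def)
      ultimately have "cycle_gain \<psi> (c @ [?s]) = 0"
        using insert.prems(1) unfolding balanced_def by blast
      then have "cycle_gain \<psi> c = \<psi> a" by (simp add: cycle_gain_def)
      moreover have "cycle_gain \<psi> c = \<sigma> (tail H a) - \<sigma> (head H a)"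
      proof (cases "c = []")
        case True then show ?thesis using c by (simp add: simple_walk_def cycle_gain_def)
      next
        case False
        then show ?thesis using walk_gain_telescope[OF \<sigma>, of c] c by (simp add: simple_walk_def)
      qed
      ultimately have "gain_potential H \<psi> (insert a F) \<sigma>"
        using \<sigma> by (simp add: gain_potential_def)
      then show ?thesis by blast
    next
      case False
      \<comment> \<open>A constant shift on \<open>C\<close> keeps the equations of the old arcs,
        none of which leaves \<open>C\<close>; its value is the one that solves the equation of
        \<open>a\<close>.\<close>
      let ?\<sigma> = "\<lambda>w. if w \<in> C then \<sigma> w + (\<psi> a + \<sigma> (head H a) - \<sigma> (tail H a)) else \<sigma> w"
      have "gain_potential H \<psi> (insert a F) ?\<sigma>"
        using \<sigma> tC False closed by (auto simp: gain_potential_def)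
      then show ?thesis by blast
    qed
  qed
qed

section \<open>Signed incidence vectors and their ranks\<close>

definition gain_sign :: "bit \<Rightarrow> real" where
  "gain_sign g = (if g = 0 then 1 else -1)"

lemma gain_sign_simps [simp]: "gain_sign 0 = 1" "gain_sign 1 = -1" "gain_sign g \<noteq> 0"
  "gain_sign g * gain_sign g = 1" "gain_sign g * (gain_sign g * x) = x" "gain_sign (- g) = gain_sign g"
  by (cases g; simp add: gain_sign_def)+

lemma gain_sign_add: "gain_sign (g + h) = gain_sign g * gain_sign h"
  by (cases g; cases h; hypsubst; simp)

lemma gain_sign_diff: "gain_sign (g - h) = gain_sign g * gain_sign h"
  by (simp only: minus_bit_def gain_sign_add)

text \<open>With gains \<open>\<psi>\<close> this is the \<alpha> of the opening overview, with
  gains \<open>\<lambda>_. 0\<close> the \<beta>. A loop gives zero if its gain is trivial and twice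
  a unit vector otherwise.\<close>

definition incidence :: "('w::finite, 'e) pre_digraph \<Rightarrow> ('e \<Rightarrow> bit) \<Rightarrow> 'e \<Rightarrow> real^'w" where
  "incidence H \<psi> a = axis (tail H a) 1 - gain_sign (\<psi> a) *\<^sub>R axis (head H a) 1"

lemma inner_incidence: "incidence H \<psi> a \<bullet> y = y $ tail H a - gain_sign (\<psi> a) * y $ head H a"
  by (simp add: incidence_def inner_diff_left inner_axis')

definition coordinate_subspace :: "'w::finite set \<Rightarrow> (real^'w) set" where
  "coordinate_subspace S = {y. \<forall>w. w \<notin> S \<longrightarrow> y $ w = 0}"

lemma subspace_coordinate_subspace: "subspace (coordinate_subspace S)"
  by (auto simp: coordinate_subspace_def subspace_def)

lemma dim_coordinate_subspace: "dim (coordinate_subspace (S :: 'w::finite set)) = card S"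
proof -
  have ind: "indep_family S (\<lambda>w. axis w 1 :: real^'w)"
    unfolding indep_family_def
  proof (intro allI impI ballI)
    fix c v assume c: "(\<Sum>w\<in>S. c w *\<^sub>R (axis w 1 :: real^'w)) = 0" and v: "v \<in> S"
    have "0 = (\<Sum>w\<in>S. c w *\<^sub>R (axis w 1 :: real^'w)) $ v" by (simp add: c)
    also have "\<dots> = (\<Sum>w\<in>S. if w = v then c w else 0)"
      unfolding sum_component by (intro sum.cong) (auto simp: axis_def)
    finally show "c v = 0" using v by simp
  qed
  have "coordinate_subspace S = span ((\<lambda>w. axis w 1) ` S)"
  proof
    show "span ((\<lambda>w. axis w 1) ` S) \<subseteq> coordinate_subspace S"
      by (intro span_minimal subspace_coordinate_subspace)
        (auto simp: coordinate_subspace_def axis_def)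
    show "coordinate_subspace S \<subseteq> span ((\<lambda>w. axis w 1) ` S)"
    proof
      fix y :: "real^'w" assume y: "y \<in> coordinate_subspace S"
      have "y = (\<Sum>w\<in>S. y $ w *\<^sub>R axis w 1)"
      proof (rule vec_eq_iff[THEN iffD2], rule allI)
        fix v
        have "(\<Sum>w\<in>S. y $ w *\<^sub>R (axis w 1 :: real^'w)) $ v = (\<Sum>w\<in>S. if w = v then y $ w else 0)"
          unfolding sum_component by (intro sum.cong) (auto simp: axis_def)
        then show "y $ v = (\<Sum>w\<in>S. y $ w *\<^sub>R (axis w 1 :: real^'w)) $ v"
          using y by (auto simp: coordinate_subspace_def)
      qed
      also have "\<dots> \<in> span ((\<lambda>w. axis w 1) ` S)"
        by (intro span_sum span_scale span_base) auto
      finally show "y \<in> span ((\<lambda>w. axis w 1) ` S)" .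
    qed
  qed
  then show ?thesis using dim_indep_family[OF _ ind] by simp
qed

lemma incidence_in_coordinate_subspace:
  "a \<in> F \<Longrightarrow> incidence H \<psi> a \<in> coordinate_subspace (arc_verts H F)"
  by (auto simp: incidence_def coordinate_subspace_def arc_verts_def axis_def)

text \<open>Connectivity is phrased by cuts: functions that agree at the ends of every arc are then
  constant, and failure directly supplies a splitting of \<open>F\<close>.\<close>

definition arc_connected :: "('w, 'e) pre_digraph \<Rightarrow> 'e set \<Rightarrow> bool" where
  "arc_connected H F \<longleftrightarrow>
     (\<forall>S. (\<forall>a\<in>F. tail H a \<in> S \<longleftrightarrow> head H a \<in> S) \<longrightarrow> arc_verts H F \<subseteq> S \<or> arc_verts H F \<inter> S = {})"

lemma arc_connected_const:
  assumes "arc_connected H F" "\<And>a. a \<in> F \<Longrightarrow> f (tail H a) = f (head H a)"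
    "u \<in> arc_verts H F" "v \<in> arc_verts H F"
  shows "f u = f v"
proof -
  have "\<forall>a\<in>F. tail H a \<in> {w. f w = f u} \<longleftrightarrow> head H a \<in> {w. f w = f u}"
    using assms(2) by auto
  then have "arc_verts H F \<subseteq> {w. f w = f u} \<or> arc_verts H F \<inter> {w. f w = f u} = {}"
    using assms(1) unfolding arc_connected_def by blast
  then show ?thesis using assms(3,4) by auto
qed

text \<open>A vector on the vertices of \<open>F\<close> orthogonal to all incidence vectors has
  equal or opposite entries at the ends of each arc. Its squared entries are therefore constant, so
  these vectors form a space of dimension at most 1. The signs of a nonzero one are a potential,
  which exists only if \<open>F\<close> is balanced.\<close>

lemma dim_incidence_connected:
  fixes H :: "('w::finite, 'e::finite) pre_digraph"
  assumes "F \<noteq> {}" "F \<subseteq> arcs H" and conn: "arc_connected H F"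
  shows "card (arc_verts H F) \<le> dim (incidence H \<psi> ` F) + 1"
    and "\<not> balanced H \<psi> F \<Longrightarrow> card (arc_verts H F) \<le> dim (incidence H \<psi> ` F)"
proof -
  let ?U = "coordinate_subspace (arc_verts H F)"
  let ?K = "{y \<in> ?U. \<forall>x\<in>span (incidence H \<psi> ` F). orthogonal x y}"
  have "dim ?K + dim (span (incidence H \<psi> ` F)) = dim ?U"
    by (intro dim_subspace_orthogonal_to_vectors subspace_coordinate_subspace subspace_span
        span_minimal) (auto intro: incidence_in_coordinate_subspace)
  then have dims: "dim ?K + dim (incidence H \<psi> ` F) = card (arc_verts H F)"
    by (simp add: dim_coordinate_subspace)
  have K: "y $ tail H a = gain_sign (\<psi> a) * y $ head H a" if "y \<in> ?K" "a \<in> F" for y a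
  proof -
    have "incidence H \<psi> a \<in> span (incidence H \<psi> ` F)" using that by (intro span_base) auto
    then have "incidence H \<psi> a \<bullet> y = 0" using that by (auto simp: orthogonal_def)
    then show ?thesis by (simp add: inner_incidence)
  qed
  have subK: "subspace ?K"
    using subspace_coordinate_subspace[of "arc_verts H F"]
    by (auto simp: subspace_def orthogonal_def inner_add_right)
  have sq: "(y $ u)\<^sup>2 = (y $ v)\<^sup>2"
    if "y \<in> ?K" "u \<in> arc_verts H F" "v \<in> arc_verts H F" for y u v
  proof (rule arc_connected_const[OF conn _ that(2,3), where f = "\<lambda>w. (y $ w)\<^sup>2"])
    fix a assume "a \<in> F"
    then show "(y $ tail H a)\<^sup>2 = (y $ head H a)\<^sup>2"
      using K[OF that(1)] by (simp add: power2_eq_square mult_ac)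
  qed
  obtain r where r: "r \<in> arc_verts H F" using assms(1) by (auto simp: arc_verts_def)
  have zero: "y = 0" if y: "y \<in> ?K" "y $ r = 0" for y
  proof -
    have "y $ w = 0" for w
      using sq[OF y(1) r, of w] y by (cases "w \<in> arc_verts H F") (auto simp: coordinate_subspace_def)
    then show ?thesis by (simp add: vec_eq_iff)
  qed
  have "dim ?K \<le> 1"
  proof (rule dim_le_1_if_proportional)
    fix x y assume x: "x \<in> ?K" "x \<noteq> 0" and y: "y \<in> ?K"
    have "x $ r \<noteq> 0" using zero x by blast
    have m: "y - (y $ r / x $ r) *\<^sub>R x \<in> ?K"
      using x y subK by (intro subspace_diff subspace_scale)
    have "y - (y $ r / x $ r) *\<^sub>R x = 0" using \<open>x $ r \<noteq> 0\<close> by (intro zero[OF m]) simp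
    then show "\<exists>c. y = c *\<^sub>R x" by (metis eq_iff_diff_eq_0)
  qed
  with dims show "card (arc_verts H F) \<le> dim (incidence H \<psi> ` F) + 1" by linarith
  assume unbal: "\<not> balanced H \<psi> F"
  have "?K \<subseteq> {0}"
  proof
    fix y assume y: "y \<in> ?K"
    show "y \<in> {0}"
    proof (rule ccontr)
      assume "y \<notin> {0}"
      then have "y $ r \<noteq> 0" using zero y by blast
      then have nz: "y $ w \<noteq> 0" if "w \<in> arc_verts H F" for w using sq[OF y r that] by auto
      define \<sigma> where "\<sigma> w = (if y $ w > 0 then 0 else 1 :: bit)" for w
      have "gain_potential H \<psi> F \<sigma>"
        unfolding gain_potential_def
      proof
        fix a assume a: "a \<in> F"
        have "y $ tail H a \<noteq> 0" "y $ head H a \<noteq> 0" using nz a by (auto simp: arc_verts_def)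
        then show "\<psi> a = \<sigma> (tail H a) - \<sigma> (head H a)"
          using K[OF y a] by (cases "\<psi> a") (auto simp: \<sigma>_def)
      qed
      then show False using unbal assms(2) by (auto simp: balanced_iff_potential)
    qed
  qed
  then have "dim ?K = 0" by (simp only: dim_eq_0)
  with dims show "card (arc_verts H F) \<le> dim (incidence H \<psi> ` F)" by linarith
qed

lemma dim_incidence_union:
  fixes H :: "('w::finite, 'e::finite) pre_digraph"
  assumes "arc_verts H F \<inter> arc_verts H G = {}"
  shows "dim (incidence H \<psi> ` (F \<union> G)) = dim (incidence H \<psi> ` F) + dim (incidence H \<psi> ` G)"
  unfolding image_Un
proof (rule dim_orthogonal_sum)
  fix x y assume "x \<in> incidence H \<psi> ` F" "y \<in> incidence H \<psi> ` G"
  then have *: "x \<in> coordinate_subspace (arc_verts H F)" "y \<in> coordinate_subspace (arc_verts H G)"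
    by (auto intro: incidence_in_coordinate_subspace)
  have "x $ w * y $ w = 0" for w using * assms by (auto simp: coordinate_subspace_def)
  then show "x \<bullet> y = 0" unfolding inner_vec_def by (intro sum.neutral) simp
qed

text \<open>
  On a connected set of arcs on \<open>N\<close> vertices the right-hand side is at least \<open>2 N - 2\<close> in the balanced case
  and \<open>2 N\<close> or \<open>2 N - 1\<close> for \<open>m = 1\<close> or \<open>m = 2\<close> otherwise; it is additive over components.
\<close>

lemma gain_sparse_imp_dim_count:
  fixes H :: "('w::finite, 'e::finite) pre_digraph"
  assumes sparse: "gain_sparse H \<psi> 2 3 m I" and IH: "I \<subseteq> arcs H"
    and m: "m = 1 \<and> \<psi>' = \<psi> \<or> m = 2"
    and F: "F \<subseteq> I" "F \<noteq> {}"
  shows "card F + 1 \<le> dim (incidence H \<psi> ` F) + dim (incidence H \<psi>' ` F)"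
  using F
proof (induction "card F" arbitrary: F rule: less_induct)
  case less
  note FI = \<open>F \<subseteq> I\<close> and Fne = \<open>F \<noteq> {}\<close>
  have FH: "F \<subseteq> arcs H" using FI IH by blast
  have count: "balanced H \<psi> F \<Longrightarrow> int (card F) \<le> 2 * int (card (arc_verts H F)) - 3"
    "int (card F) \<le> 2 * int (card (arc_verts H F)) - int m"
    using sparse FI Fne unfolding gain_sparse_def by force+
  show ?case
  proof (cases "arc_connected H F")
    case True
    note d = dim_incidence_connected[OF Fne FH True]
    show ?thesis
    proof (cases "balanced H \<psi> F")
      case True
      then show ?thesis using count(1) d(1)[of \<psi>] d(1)[of \<psi>'] by linarith
    next
      case False
      then show ?thesis using count(2) d(2)[of \<psi>] d(1)[of \<psi>'] m by auto
    qed
  next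
    case False
    then obtain S where S: "\<forall>a\<in>F. tail H a \<in> S \<longleftrightarrow> head H a \<in> S" "\<not> arc_verts H F \<subseteq> S"
      "arc_verts H F \<inter> S \<noteq> {}"
      by (auto simp: arc_connected_def)
    define A B where "A = {a\<in>F. tail H a \<in> S}" and "B = {a\<in>F. tail H a \<notin> S}"
    have AB: "F = A \<union> B" "A \<inter> B = {}" by (auto simp: A_def B_def)
    have ne: "A \<noteq> {}" "B \<noteq> {}" using S by (auto simp: A_def B_def arc_verts_def)
    have "arc_verts H A \<subseteq> S" "arc_verts H B \<subseteq> - S"
      using S(1) by (auto simp: A_def B_def arc_verts_def)
    then have disj: "arc_verts H A \<inter> arc_verts H B = {}" by blast
    have cardF: "card F = card A + card B" using AB by (simp add: card_Un_disjoint)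
    moreover have "card A > 0" "card B > 0" using ne by (auto simp: card_gt_0_iff)
    ultimately have "card A < card F" "card B < card F" by auto
    then have "card A + 1 \<le> dim (incidence H \<psi> ` A) + dim (incidence H \<psi>' ` A)"
      "card B + 1 \<le> dim (incidence H \<psi> ` B) + dim (incidence H \<psi>' ` B)"
      using less.hyps AB FI ne by auto
    \<comment> \<open>The bounds for the two pieces add up to \<open>card F + 2\<close>, one more
      than claimed.\<close>
    then show ?thesis
      using dim_incidence_union[OF disj] cardF AB(1) by simp
  qed
qed

section \<open>Rows of the symmetry blocks\<close>

text \<open>
  The point \<open>h = (x, y)\<close> lists, for each vertex orbit, the coordinates of its representative along
  and across the mirror.
\<close>

definition sym_row ::
    "('w::finite, 'e) pre_digraph \<Rightarrow> ('e \<Rightarrow> bit) \<Rightarrow> (real^'w) \<times> (real^'w) \<Rightarrow> 'e \<Rightarrow>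
     (real^'w) \<times> (real^'w)" where
  "sym_row H \<psi> h a = ((incidence H (\<lambda>_. 0) a \<bullet> fst h) *\<^sub>R incidence H (\<lambda>_. 0) a,
     (incidence H \<psi> a \<bullet> snd h) *\<^sub>R incidence H \<psi> a)"

definition antisym_row ::
    "('w::finite, 'e) pre_digraph \<Rightarrow> ('e \<Rightarrow> bit) \<Rightarrow> (real^'w) \<times> (real^'w) \<Rightarrow> 'e \<Rightarrow>
     (real^'w) \<times> (real^'w)" where
  "antisym_row H \<psi> h a = ((incidence H (\<lambda>_. 0) a \<bullet> fst h) *\<^sub>R incidence H \<psi> a,
     (incidence H \<psi> a \<bullet> snd h) *\<^sub>R incidence H (\<lambda>_. 0) a)"

text \<open>The differences along and across the mirror do not both vanish: the ends of every edge
  lie at distinct points.\<close>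

definition nondegenerate ::
    "('w::finite, 'e) pre_digraph \<Rightarrow> ('e \<Rightarrow> bit) \<Rightarrow> (real^'w) \<times> (real^'w) \<Rightarrow> bool" where
  "nondegenerate H \<psi> h \<longleftrightarrow>
     (\<forall>a\<in>arcs H. incidence H (\<lambda>_. 0) a \<bullet> fst h \<noteq> 0 \<or> incidence H \<psi> a \<bullet> snd h \<noteq> 0)"

section \<open>Trivial motions bound the size of independent sets\<close>

text \<open>Applied with \<open>U\<close> the space of vectors on the vertices of \<open>F\<close>
  and \<open>T\<close> a set of trivial motions, to which all rows are orthogonal.\<close>

lemma card_add_dim_le:
  fixes r :: "'e \<Rightarrow> 'a::euclidean_space"
  assumes "indep_family F r" "finite F" "\<And>a. a \<in> F \<Longrightarrow> r a \<in> U" "T \<subseteq> U"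
    "\<And>a t. a \<in> F \<Longrightarrow> t \<in> T \<Longrightarrow> r a \<bullet> t = 0"
  shows "card F + dim T \<le> dim U"
proof -
  have "dim (r ` F \<union> T) = dim (r ` F) + dim T"
    by (rule dim_orthogonal_sum) (use assms(5) in auto)
  also have "dim (r ` F) = card F" using assms by (simp add: dim_indep_family)
  finally show ?thesis
    using dim_subset[of "r ` F \<union> T" U] assms(3,4) by auto
qed

lemma dim_triple_eq_3:
  fixes u v w :: "'a::euclidean_space"
  assumes "\<And>a b c. a *\<^sub>R u + b *\<^sub>R v + c *\<^sub>R w = 0 \<Longrightarrow> a = 0 \<and> b = 0 \<and> c = 0"
  shows "dim {u, v, w} = 3"
proof -
  have "indep_family {0, 1, 2} (\<lambda>i::nat. [u, v, w] ! i)"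
    unfolding indep_family_def
  proof (intro allI impI)
    fix c :: "nat \<Rightarrow> real" assume "(\<Sum>i\<in>{0, 1, 2}. c i *\<^sub>R [u, v, w] ! i) = 0"
    then have "c 0 *\<^sub>R u + c 1 *\<^sub>R v + c 2 *\<^sub>R w = 0" by (simp add: numeral_2_eq_2 add.assoc)
    from assms[OF this] show "\<forall>i\<in>{0, 1, 2}. c i = 0" by simp
  qed
  from dim_indep_family[OF _ this] show ?thesis by (simp add: numeral_2_eq_2)
qed

lemma dim_pair_eq_2:
  fixes u v :: "'a::euclidean_space"
  assumes "\<And>a b. a *\<^sub>R u + b *\<^sub>R v = 0 \<Longrightarrow> a = 0 \<and> b = 0"
  shows "dim {u, v} = 2"
proof -
  have "indep_family {0, 1} (\<lambda>i::nat. [u, v] ! i)"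
    unfolding indep_family_def
  proof (intro allI impI)
    fix c :: "nat \<Rightarrow> real" assume "(\<Sum>i\<in>{0, 1}. c i *\<^sub>R [u, v] ! i) = 0"
    then have "c 0 *\<^sub>R u + c 1 *\<^sub>R v = 0" by simp
    from assms[OF this] show "\<forall>i\<in>{0, 1}. c i = 0" by simp
  qed
  from dim_indep_family[OF _ this] show ?thesis by simp
qed

text \<open>Cutting a motion off outside the vertices of \<open>F\<close> puts it into their
  coordinate subspace and leaves its pairings with the rows of \<open>F\<close> unchanged.\<close>

definition restrict_vec :: "'w::finite set \<Rightarrow> ('w \<Rightarrow> real) \<Rightarrow> real^'w" where
  "restrict_vec S f = (\<chi> w. if w \<in> S then f w else 0)"

lemma restrict_vec_mem: "restrict_vec S f \<in> coordinate_subspace S"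
  by (simp add: restrict_vec_def coordinate_subspace_def)

lemma restrict_vec_linear:
  "restrict_vec S f + restrict_vec S g = restrict_vec S (\<lambda>w. f w + g w)"
  "a *\<^sub>R restrict_vec S f = restrict_vec S (\<lambda>w. a * f w)"
  by (auto simp: restrict_vec_def vec_eq_iff)

lemma restrict_vec_eq_0: "restrict_vec S f = 0 \<longleftrightarrow> (\<forall>w\<in>S. f w = 0)"
  by (auto simp: restrict_vec_def vec_eq_iff)

lemma restrict_vec_ends:
  "a \<in> F \<Longrightarrow> restrict_vec (arc_verts H F) f $ tail H a = f (tail H a)"
  "a \<in> F \<Longrightarrow> restrict_vec (arc_verts H F) f $ head H a = f (head H a)"
  by (auto simp: restrict_vec_def arc_verts_def)

lemma rows_in_subspace:
  fixes H :: "('w::finite, 'e::finite) pre_digraph"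
  assumes "a \<in> F"
  defines "U \<equiv> coordinate_subspace (arc_verts H F) \<times> coordinate_subspace (arc_verts H F)"
  shows "sym_row H \<psi> h a \<in> U" "antisym_row H \<psi> h a \<in> U"
  unfolding U_def sym_row_def antisym_row_def
  using assms(1) by (auto intro!: subspace_scale subspace_coordinate_subspace incidence_in_coordinate_subspace)

lemma balanced_sign:
  assumes "balanced H \<psi> F" "F \<subseteq> arcs H" "finite F"
  obtains \<sigma> :: "'w \<Rightarrow> real" where "\<And>w. \<sigma> w * \<sigma> w = 1"
    "\<And>a. a \<in> F \<Longrightarrow> gain_sign (\<psi> a) = \<sigma> (tail H a) * \<sigma> (head H a)"
proof -
  obtain \<rho> where "gain_potential H \<psi> F \<rho>"
    using assms balanced_iff_potential by blast
  then show thesis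
    by (intro that[of "\<lambda>w. gain_sign (\<rho> w)"])
      (auto simp: gain_potential_def gain_sign_diff simp del: minus_bit_def)
qed

context
  fixes H :: "('w::finite, 'e::finite) pre_digraph" and \<psi> :: "'e \<Rightarrow> bit" and x y :: "real^'w"
    and F :: "'e set"
  assumes nd: "nondegenerate H \<psi> (x, y)" and FH: "F \<subseteq> arcs H" and Fne: "F \<noteq> {}"
begin

text \<open>The source of independence of the trivial motions: a dependency that involves the
  rotation would collapse an edge to a point.\<close>

lemma nondegenerate_ends:
  assumes "\<And>u v. u \<in> arc_verts H F \<Longrightarrow> v \<in> arc_verts H F \<Longrightarrow> x $ u = x $ v"
    "\<And>a. a \<in> F \<Longrightarrow> y $ tail H a = gain_sign (\<psi> a) * y $ head H a"
  shows False
proof -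
  obtain a where a: "a \<in> F" using Fne by blast
  then have "tail H a \<in> arc_verts H F" "head H a \<in> arc_verts H F" by (auto simp: arc_verts_def)
  then have "x $ tail H a = x $ head H a" using assms(1) by blast
  then show False using nd FH assms(2) a by (auto simp: nondegenerate_def inner_incidence)
qed

lemma ex_arc_vert: "\<exists>v. v \<in> arc_verts H F"
  using Fne by (auto simp: arc_verts_def)

lemma dim_arc_vert_subspace: "dim (coordinate_subspace (arc_verts H F) \<times> coordinate_subspace (arc_verts H F)) = 2 * card (arc_verts H F)"
  by (simp add: dim_Times subspace_coordinate_subspace dim_coordinate_subspace)

lemmas row_simps = sym_row_def antisym_row_def inner_prod_def inner_incidence restrict_vec_ends

text \<open>Translation along the mirror is symmetric whatever the gains are, and costs one
  dimension.\<close>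

lemma card_sym_independent:
  assumes "indep_family F (sym_row H \<psi> (x, y))"
  shows "card F + 1 \<le> 2 * card (arc_verts H F)"
proof -
  let ?t = "(restrict_vec (arc_verts H F) (\<lambda>_. 1), restrict_vec (arc_verts H F) (\<lambda>_. 0))"
  have "card F + dim {?t} \<le> dim (coordinate_subspace (arc_verts H F) \<times> coordinate_subspace (arc_verts H F))"
    by (rule card_add_dim_le[OF assms])
      (auto simp: rows_in_subspace restrict_vec_mem, auto simp: row_simps)
  moreover have "?t \<noteq> 0" using ex_arc_vert by (auto simp: zero_prod_def restrict_vec_eq_0)
  ultimately show ?thesis using dim_arc_vert_subspace by (simp add: dim_insert)
qed

text \<open>Translation across the mirror \<open>?t\<close> and the rotation \<open>?r\<close> are
  antisymmetric. Were they dependent, \<open>y\<close> would vanish and \<open>x\<close> be constant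
  on the vertices of \<open>F\<close>, against nondegeneracy.\<close>

lemma card_antisym_independent:
  assumes "indep_family F (antisym_row H \<psi> (x, y))"
  shows "card F + 2 \<le> 2 * card (arc_verts H F)"
proof -
  let ?t = "(restrict_vec (arc_verts H F) (\<lambda>_. 0), restrict_vec (arc_verts H F) (\<lambda>_. 1))"
    and ?r = "(restrict_vec (arc_verts H F) (\<lambda>w. - y $ w), restrict_vec (arc_verts H F) (\<lambda>w. x $ w))"
  have "card F + dim {?t, ?r} \<le> dim (coordinate_subspace (arc_verts H F) \<times> coordinate_subspace (arc_verts H F))"
    by (rule card_add_dim_le[OF assms])
      (auto simp: rows_in_subspace restrict_vec_mem, auto simp: row_simps algebra_simps)
  moreover have "dim {?t, ?r} = 2"
  proof (rule dim_pair_eq_2)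
    fix a b :: real assume "a *\<^sub>R ?t + b *\<^sub>R ?r = 0"
    then have e: "\<And>w. w \<in> arc_verts H F \<Longrightarrow> b * y $ w = 0" "\<And>w. w \<in> arc_verts H F \<Longrightarrow> a + b * x $ w = 0"
      by (auto simp: zero_prod_def restrict_vec_linear restrict_vec_eq_0)
    have "b = 0"
    proof (rule ccontr)
      assume "b \<noteq> 0"
      then have "\<And>w. w \<in> arc_verts H F \<Longrightarrow> y $ w = 0" "\<And>w. w \<in> arc_verts H F \<Longrightarrow> x $ w = - a / b"
        using e by (auto simp: field_simps eq_neg_iff_add_eq_0)
      then show False using nondegenerate_ends by (simp add: arc_verts_def)
    qed
    then show "a = 0 \<and> b = 0" using e(2) ex_arc_vert by auto
  qed
  ultimately show ?thesis using dim_arc_vert_subspace by simp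
qed

lemma balanced_nondegenerate:
  assumes "\<And>a. a \<in> F \<Longrightarrow> gain_sign (\<psi> a) = \<sigma> (tail H a) * \<sigma> (head H a)" "\<And>w. \<sigma> w * \<sigma> w = 1"
    "\<And>w. w \<in> arc_verts H F \<Longrightarrow> x $ w = c" "\<And>w. w \<in> arc_verts H F \<Longrightarrow> y $ w = d * \<sigma> w"
  shows False
proof (rule nondegenerate_ends)
  fix a assume a: "a \<in> F"
  then have "y $ tail H a = d * \<sigma> (tail H a)" "y $ head H a = d * \<sigma> (head H a)"
    using assms(4) by (auto simp: arc_verts_def)
  then have "gain_sign (\<psi> a) * y $ head H a = d * \<sigma> (tail H a) * (\<sigma> (head H a) * \<sigma> (head H a))"
    using assms(1)[OF a] by simp
  then show "y $ tail H a = gain_sign (\<psi> a) * y $ head H a"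
    using \<open>y $ tail H a = _\<close> assms(2) by simp
qed (simp add: assms(3))

text \<open>On a balanced set the potential signs make all three trivial motions of the plane
  available in either block, hence the constant 3.\<close>

lemma card_balanced_independent:
  assumes ind: "indep_family F (sym_row H \<psi> (x, y)) \<or> indep_family F (antisym_row H \<psi> (x, y))"
    and bal: "balanced H \<psi> F"
  shows "card F + 3 \<le> 2 * card (arc_verts H F)"
proof -
  obtain \<sigma> :: "'w \<Rightarrow> real" where \<sigma>1: "\<And>w. \<sigma> w * \<sigma> w = 1"
    and \<sigma>: "\<And>a. a \<in> F \<Longrightarrow> gain_sign (\<psi> a) = \<sigma> (tail H a) * \<sigma> (head H a)"
    using balanced_sign[OF bal FH finite] by blast
  have \<sigma>2: "\<sigma> w * (\<sigma> w * z) = z" for w z using \<sigma>1[of w] by (metis mult.assoc mult_1)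
  have \<sigma>3: "\<sigma> w \<noteq> 0" for w using \<sigma>1[of w] by auto
  let ?U = "coordinate_subspace (arc_verts H F) \<times> coordinate_subspace (arc_verts H F)" and ?R = "restrict_vec (arc_verts H F)"
  obtain v0 where v0: "v0 \<in> arc_verts H F" using ex_arc_vert by blast
  from ind show ?thesis
  proof
    assume ind: "indep_family F (sym_row H \<psi> (x, y))"
    \<comment> \<open>Switching by \<open>\<sigma>\<close> removes all gains: two translations and the rotation.\<close>
    let ?t = "(?R (\<lambda>_. 1), ?R (\<lambda>_. 0))" and ?s = "(?R (\<lambda>_. 0), ?R \<sigma>)"
      and ?r = "(?R (\<lambda>w. - \<sigma> w * y $ w), ?R (\<lambda>w. \<sigma> w * x $ w))"
    have "card F + dim {?t, ?s, ?r} \<le> dim ?U"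
      by (rule card_add_dim_le[OF ind])
        (auto simp: rows_in_subspace restrict_vec_mem,
         auto simp: row_simps \<sigma> \<sigma>1 \<sigma>2 algebra_simps)
    moreover have "dim {?t, ?s, ?r} = 3"
    proof (rule dim_triple_eq_3)
      fix a b c :: real assume "a *\<^sub>R ?t + b *\<^sub>R ?s + c *\<^sub>R ?r = 0"
      then have e: "\<And>w. w \<in> arc_verts H F \<Longrightarrow> a - c * (\<sigma> w * y $ w) = 0"
        "\<And>w. w \<in> arc_verts H F \<Longrightarrow> b * \<sigma> w + c * (\<sigma> w * x $ w) = 0"
        by (auto simp: zero_prod_def restrict_vec_linear restrict_vec_eq_0)
      have "c = 0"
      proof (rule ccontr)
        assume c: "c \<noteq> 0"
        have "x $ w = - b / c" if "w \<in> arc_verts H F" for w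
        proof -
          have "\<sigma> w * (b + c * x $ w) = 0" using e(2)[OF that] by (simp add: algebra_simps)
          then have "b + c * x $ w = 0" using \<sigma>3 mult_eq_0_iff by blast
          then show ?thesis using c by (simp add: field_simps eq_neg_iff_add_eq_0)
        qed
        moreover have "y $ w = (a / c) * \<sigma> w" if "w \<in> arc_verts H F" for w
        proof -
          have "\<sigma> w * y $ w = a / c" using e(1)[OF that] c by (simp add: field_simps)
          then have "\<sigma> w * (\<sigma> w * y $ w) = \<sigma> w * (a / c)" by simp
          then show ?thesis using \<sigma>2 by simp
        qed
        ultimately show False using balanced_nondegenerate[OF \<sigma> \<sigma>1] by blast
      qed
      then show "a = 0 \<and> b = 0 \<and> c = 0" using e[OF v0] \<sigma>3 by simp
    qed
    ultimately show ?thesis using dim_arc_vert_subspace by simp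
  next
    assume ind: "indep_family F (antisym_row H \<psi> (x, y))"
    \<comment> \<open>In this block the gains act on the first component, so only the translation
      along the mirror is switched by \<open>\<sigma>\<close>.\<close>
    let ?t = "(?R (\<lambda>_. 0), ?R (\<lambda>_. 1))" and ?s = "(?R \<sigma>, ?R (\<lambda>_. 0))"
      and ?r = "(?R (\<lambda>w. - y $ w), ?R (\<lambda>w. x $ w))"
    have "card F + dim {?t, ?s, ?r} \<le> dim ?U"
      by (rule card_add_dim_le[OF ind])
        (auto simp: rows_in_subspace restrict_vec_mem,
         auto simp: row_simps \<sigma> \<sigma>1 \<sigma>2 algebra_simps)
    moreover have "dim {?t, ?s, ?r} = 3"
    proof (rule dim_triple_eq_3)
      fix a b c :: real assume "a *\<^sub>R ?t + b *\<^sub>R ?s + c *\<^sub>R ?r = 0"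
      then have e: "\<And>w. w \<in> arc_verts H F \<Longrightarrow> b * \<sigma> w - c * y $ w = 0"
        "\<And>w. w \<in> arc_verts H F \<Longrightarrow> a + c * x $ w = 0"
        by (auto simp: zero_prod_def restrict_vec_linear restrict_vec_eq_0)
      have "c = 0"
      proof (rule ccontr)
        assume c: "c \<noteq> 0"
        have "x $ w = - a / c" if "w \<in> arc_verts H F" for w
          using e(2)[OF that] c by (simp add: field_simps eq_neg_iff_add_eq_0)
        moreover have "y $ w = (b / c) * \<sigma> w" if "w \<in> arc_verts H F" for w
          using e(1)[OF that] c by (simp add: field_simps)
        ultimately show False using balanced_nondegenerate[OF \<sigma> \<sigma>1] by blast
      qed
      then show "a = 0 \<and> b = 0 \<and> c = 0" using e[OF v0] \<sigma>3 by simp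
    qed
    ultimately show ?thesis using dim_arc_vert_subspace by simp
  qed
qed

end

lemma gain_sparse_of_independent:
  fixes H :: "('w::finite, 'e::finite) pre_digraph"
  assumes nd: "nondegenerate H \<psi> h" and IH: "I \<subseteq> arcs H"
  shows "indep_family I (sym_row H \<psi> h) \<Longrightarrow> gain_sparse H \<psi> 2 3 1 I"
    and "indep_family I (antisym_row H \<psi> h) \<Longrightarrow> gain_sparse H \<psi> 2 3 2 I"
proof -
  obtain x y where h: "h = (x, y)" by (cases h)
  note nd = nd[unfolded h] and sub = indep_family_subset[OF _ _ finite]
  show "gain_sparse H \<psi> 2 3 1 I" if ind: "indep_family I (sym_row H \<psi> h)"
    unfolding gain_sparse_def
  proof (intro allI impI conjI)
    fix F assume F: "F \<subseteq> I" "F \<noteq> {}"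
    have iF: "indep_family F (sym_row H \<psi> (x, y))" using sub[OF ind F(1)] by (simp add: h)
    show "int (card F) \<le> int 2 * int (card (arc_verts H F)) - int 1"
      using card_sym_independent[OF nd subset_trans[OF F(1) IH] F(2) iF] by simp
    show "int (card F) \<le> int 2 * int (card (arc_verts H F)) - int 3" if "balanced H \<psi> F"
      using card_balanced_independent[OF nd subset_trans[OF F(1) IH] F(2) _ that] iF by fastforce
  qed
  show "gain_sparse H \<psi> 2 3 2 I" if ind: "indep_family I (antisym_row H \<psi> h)"
    unfolding gain_sparse_def
  proof (intro allI impI conjI)
    fix F assume F: "F \<subseteq> I" "F \<noteq> {}"
    have iF: "indep_family F (antisym_row H \<psi> (x, y))" using sub[OF ind F(1)] by (simp add: h)
    show "int (card F) \<le> int 2 * int (card (arc_verts H F)) - int 2"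
      using card_antisym_independent[OF nd subset_trans[OF F(1) IH] F(2) iF] by simp
    show "int (card F) \<le> int 2 * int (card (arc_verts H F)) - int 3" if "balanced H \<psi> F"
      using card_balanced_independent[OF nd subset_trans[OF F(1) IH] F(2) _ that] iF by fastforce
  qed
qed

lemma row_inner_polynomial:
  fixes H :: "('w::finite, 'e::finite) pre_digraph"
  shows "real_polynomial_function (\<lambda>h. sym_row H \<psi> h a \<bullet> sym_row H \<psi> h b)"
    and "real_polynomial_function (\<lambda>h. antisym_row H \<psi> h a \<bullet> antisym_row H \<psi> h b)"
proof -
  have "real_polynomial_function (\<lambda>h::(real^'w) \<times> (real^'w). v \<bullet> fst h)"
    "real_polynomial_function (\<lambda>h::(real^'w) \<times> (real^'w). v \<bullet> snd h)" for v
    by (auto intro!: real_polynomial_function.intros(1) bounded_linear_inner_right_comp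
        bounded_linear_fst bounded_linear_snd)
  note * = this real_polynomial_function.intros(2-4)
  show "real_polynomial_function (\<lambda>h. sym_row H \<psi> h a \<bullet> sym_row H \<psi> h b)"
    "real_polynomial_function (\<lambda>h. antisym_row H \<psi> h a \<bullet> antisym_row H \<psi> h b)"
    unfolding sym_row_def antisym_row_def inner_prod_def fst_conv snd_conv inner_scaleR_left
      inner_scaleR_right
    by (intro *)+
qed

section \<open>Sparse sets are independent at generic points\<close>

text \<open>For \<open>m = 2\<close> the second gain function in the dimension count is free and is
  chosen trivial. The quarter turn \<open>(- snd h, fst h)\<close> matches the normal vector of the
  hyperplane with the point of the framework.\<close>

lemma generic_antisym_independent:
  fixes H :: "('w::finite, 'e::finite) pre_digraph"
  assumes "gain_sparse H \<psi> 2 3 2 I" "I \<subseteq> arcs H"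
  shows "generic (\<lambda>h. indep_family I (antisym_row H \<psi> h))"
proof -
  have "card F + 1 \<le> dim (incidence H \<psi> ` F) + dim (incidence H (\<lambda>_. 0) ` F)"
    if "F \<subseteq> I" "F \<noteq> {}" for F
    using gain_sparse_imp_dim_count[OF assms _ that] by simp
  from dilworth_truncation[OF this] obtain h where
    "indep_family I (\<lambda>e. truncated_row (incidence H \<psi>) (incidence H (\<lambda>_. 0)) e h)" by blast
  moreover have "antisym_row H \<psi> (- snd h, fst h) =
      (\<lambda>e. truncated_row (incidence H \<psi>) (incidence H (\<lambda>_. 0)) e h)"
    by (auto simp: antisym_row_def truncated_row_def fun_eq_iff)
  ultimately have "indep_family I (antisym_row H \<psi> (- snd h, fst h))" by simp
  then show ?thesis
    by (rule generic_indep_family[OF row_inner_polynomial(2)])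
qed

lemma incidence_nth:
  "incidence H \<psi> a $ w = (if w = tail H a then 1 else 0) - gain_sign (\<psi> a) * (if w = head H a then 1 else 0)"
  by (simp add: incidence_def axis_def)

text \<open>
  The projective map \<open>(X, Y) \<mapsto> (X / Y, 1 / Y)\<close> conjugates the half-turn about the origin to the reflection
  in the first axis. It carries the rows of half-turn symmetric rigidity, which are truncated rows, to
  the rows of the symmetric block.
\<close>

lemma sym_row_projective:
  fixes H :: "('w::finite, 'e::finite) pre_digraph" and X Y :: "real^'w" and \<psi> :: "'e \<Rightarrow> bit"
  assumes Y: "\<And>w. Y $ w \<noteq> 0"
  defines "f \<equiv> \<lambda>(p, q). (\<chi> w. (p $ w - X $ w * q $ w) / Y $ w, - q)"
  defines "r \<equiv> sym_row H \<psi> (\<chi> w. X $ w / Y $ w, \<chi> w. 1 / Y $ w)"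
  shows "f (r a) = (gain_sign (\<psi> a) / (Y $ tail H a * Y $ head H a)) *\<^sub>R
    ((incidence H \<psi> a \<bullet> X) *\<^sub>R incidence H \<psi> a, (incidence H \<psi> a \<bullet> Y) *\<^sub>R incidence H \<psi> a)"
proof -
  have Y': "Y $ tail H a \<noteq> 0" "Y $ head H a \<noteq> 0" using Y by auto
  have "gain_sign (\<psi> a) = 1 \<or> gain_sign (\<psi> a) = -1" by (cases "\<psi> a") auto
  then show ?thesis
    unfolding f_def r_def sym_row_def
    using Y' by (auto simp: vec_eq_iff inner_incidence incidence_nth field_simps)
qed

text \<open>For \<open>m = 1\<close> both incidence families carry the gains \<open>\<psi>\<close>,
  so truncation yields a half-turn symmetric point. Genericity moves it off the line at which the
  projective map is undefined before it is transported.\<close>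

lemma generic_sym_independent:
  fixes H :: "('w::finite, 'e::finite) pre_digraph"
  assumes "gain_sparse H \<psi> 2 3 1 I" "I \<subseteq> arcs H"
  shows "generic (\<lambda>h. indep_family I (sym_row H \<psi> h))"
proof -
  let ?\<alpha> = "incidence H \<psi>"
  have "card F + 1 \<le> dim (?\<alpha> ` F) + dim (?\<alpha> ` F)" if "F \<subseteq> I" "F \<noteq> {}" for F
    using gain_sparse_imp_dim_count[OF assms _ that] by simp
  from dilworth_truncation[OF this] obtain h0 where
    "indep_family I (\<lambda>e. truncated_row ?\<alpha> ?\<alpha> e h0)" by blast
  then have "generic (\<lambda>h. indep_family I (\<lambda>e. truncated_row ?\<alpha> ?\<alpha> e h))"
    by (rule generic_indep_family[OF truncated_row_inner_polynomial])
  moreover have "generic (\<lambda>h::(real^'w) \<times> (real^'w). \<forall>w\<in>UNIV. fst h $ w \<noteq> 0)"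
  proof (rule generic_ball)
    fix w :: 'w
    have "real_polynomial_function (\<lambda>h::(real^'w) \<times> (real^'w). fst h $ w)"
      by (intro real_polynomial_function.intros(1) bounded_linear_compose[OF bounded_linear_vec_nth]
          bounded_linear_fst)
    then show "generic (\<lambda>h::(real^'w) \<times> (real^'w). fst h $ w \<noteq> 0)"
      by (rule generic_polynomial[of _ "(\<chi> w. 1, 0)"]) auto
  qed simp
  ultimately obtain h where h: "indep_family I (\<lambda>e. truncated_row ?\<alpha> ?\<alpha> e h)"
    "\<And>w. fst h $ w \<noteq> 0"
    using generic_ex[OF generic_conj] by blast
  \<comment> \<open>With this choice the truncated row at \<open>h\<close> is \<open>((\<alpha>
    \<bullet> X) \<alpha>, (\<alpha> \<bullet> Y) \<alpha>)\<close>; the denominators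
    \<open>Y\<close> are the coordinates \<open>fst h\<close> that were made nonzero.\<close>
  define X Y where "X = - snd h" and "Y = fst h"
  let ?f = "\<lambda>(p, q). (\<chi> w. (p $ w - X $ w * q $ w) / Y $ w, - q)"
  have "linear ?f"
    by (rule linearI) (auto simp: vec_eq_iff algebra_simps add_divide_distrib diff_divide_distrib)
  then have "indep_family I (sym_row H \<psi> (\<chi> w. X $ w / Y $ w, \<chi> w. 1 / Y $ w))"
  proof (rule indep_family_linear_image)
    show "?f (sym_row H \<psi> (\<chi> w. X $ w / Y $ w, \<chi> w. 1 / Y $ w) e) =
        (gain_sign (\<psi> e) / (Y $ tail H e * Y $ head H e)) *\<^sub>R truncated_row ?\<alpha> ?\<alpha> e h" for e
      by (subst sym_row_projective) (use h(2) in \<open>auto simp: truncated_row_def X_def Y_def\<close>)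
  qed (use h in \<open>auto simp: Y_def\<close>)
  then show ?thesis
    by (rule generic_indep_family[OF row_inner_polynomial(1)])
qed

section \<open>Block ranks against the ranks of the count matroids\<close>

lemma gain_matroid_rank_ge:
  fixes H :: "('w, 'e::finite) pre_digraph"
  shows "I \<subseteq> arcs H \<Longrightarrow> gain_sparse H \<psi> k l m I \<Longrightarrow> card I \<le> gain_matroid_rank H \<psi> k l m"
  unfolding gain_matroid_rank_def by (intro Max_ge) auto

lemma gain_matroid_rank_attained:
  fixes H :: "('w, 'e::finite) pre_digraph"
  obtains I where "I \<subseteq> arcs H" "gain_sparse H \<psi> k l m I" "card I = gain_matroid_rank H \<psi> k l m"
proof -
  have "gain_sparse H \<psi> k l m {}" by (simp add: gain_sparse_def)
  then have "gain_matroid_rank H \<psi> k l m \<in> card ` {I. I \<subseteq> arcs H \<and> gain_sparse H \<psi> k l m I}"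
    unfolding gain_matroid_rank_def by (intro Max_in) auto
  then show thesis using that by auto
qed

lemma dim_rows_le:
  fixes H :: "('w::finite, 'e::finite) pre_digraph"
  assumes "nondegenerate H \<psi> h"
  shows "dim (sym_row H \<psi> h ` arcs H) \<le> gain_matroid_rank H \<psi> 2 3 1"
    and "dim (antisym_row H \<psi> h ` arcs H) \<le> gain_matroid_rank H \<psi> 2 3 2"
proof -
  obtain I where "I \<subseteq> arcs H" "indep_family I (sym_row H \<psi> h)" "card I = dim (sym_row H \<psi> h ` arcs H)"
    using ex_indep_family_spanning[OF finite] by metis
  then show "dim (sym_row H \<psi> h ` arcs H) \<le> gain_matroid_rank H \<psi> 2 3 1"
    using gain_matroid_rank_ge gain_sparse_of_independent[OF assms] by metis
  obtain J where "J \<subseteq> arcs H" "indep_family J (antisym_row H \<psi> h)" "card J = dim (antisym_row H \<psi> h ` arcs H)"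
    using ex_indep_family_spanning[OF finite] by metis
  then show "dim (antisym_row H \<psi> h ` arcs H) \<le> gain_matroid_rank H \<psi> 2 3 2"
    using gain_matroid_rank_ge gain_sparse_of_independent[OF assms] by metis
qed

text \<open>A sum of two squares turns the disjunction for an arc into one polynomial, and
  \<open>h0\<close> shows that it is not identically zero.\<close>

lemma generic_nondegenerate:
  fixes H :: "('w::finite, 'e::finite) pre_digraph"
  assumes "nondegenerate H \<psi> h0"
  shows "generic (nondegenerate H \<psi>)"
  unfolding nondegenerate_def
proof (rule generic_ball)
  fix a assume a: "a \<in> arcs H"
  let ?f = "\<lambda>h. (incidence H (\<lambda>_. 0) a \<bullet> fst h) * (incidence H (\<lambda>_. 0) a \<bullet> fst h) +
    (incidence H \<psi> a \<bullet> snd h) * (incidence H \<psi> a \<bullet> snd h)"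
  show "generic (\<lambda>h. incidence H (\<lambda>_. 0) a \<bullet> fst h \<noteq> 0 \<or> incidence H \<psi> a \<bullet> snd h \<noteq> 0)"
  proof (rule generic_polynomial[of ?f h0])
    show "real_polynomial_function ?f"
      by (intro real_polynomial_function.intros bounded_linear_inner_right_comp
        bounded_linear_fst bounded_linear_snd)
    show "?f h0 \<noteq> 0"
      using assms a by (auto simp: nondegenerate_def sum_squares_eq_zero_iff)
  qed auto
qed simp

lemma ex_generic_realization:
  fixes H :: "('w::finite, 'e::finite) pre_digraph"
  assumes "nondegenerate H \<psi> h0"
  obtains h where "nondegenerate H \<psi> h"
    "gain_matroid_rank H \<psi> 2 3 1 \<le> dim (sym_row H \<psi> h ` arcs H)"
    "gain_matroid_rank H \<psi> 2 3 2 \<le> dim (antisym_row H \<psi> h ` arcs H)"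
proof -
  obtain I where I: "I \<subseteq> arcs H" "gain_sparse H \<psi> 2 3 1 I" "card I = gain_matroid_rank H \<psi> 2 3 1"
    by (rule gain_matroid_rank_attained)
  obtain J where J: "J \<subseteq> arcs H" "gain_sparse H \<psi> 2 3 2 J" "card J = gain_matroid_rank H \<psi> 2 3 2"
    by (rule gain_matroid_rank_attained)
  obtain h where h: "nondegenerate H \<psi> h" "indep_family I (sym_row H \<psi> h)"
    "indep_family J (antisym_row H \<psi> h)"
    using generic_ex[OF generic_conj[OF generic_nondegenerate[OF assms]
      generic_conj[OF generic_sym_independent[OF I(2,1)] generic_antisym_independent[OF J(2,1)]]]]
    by blast
  have "card I \<le> dim (sym_row H \<psi> h ` arcs H)"
    unfolding dim_indep_family[OF finite h(2), symmetric] using I(1) by (intro dim_subset image_mono)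
  moreover have "card J \<le> dim (antisym_row H \<psi> h ` arcs H)"
    unfolding dim_indep_family[OF finite h(3), symmetric] using J(1) by (intro dim_subset image_mono)
  ultimately show thesis using that h(1) I(3) J(3) by simp
qed

section \<open>Block decomposition of the rigidity matrix\<close>

text \<open>Half sums and half differences of the two kinds of pairs recover \<open>(f a, 0)\<close>
  and \<open>(0, g a)\<close>, so the span is a product.\<close>

lemma dim_signed_pairs:
  fixes f :: "'e \<Rightarrow> 'a::euclidean_space" and g :: "'e \<Rightarrow> 'b::euclidean_space"
  shows "dim ((\<lambda>a. (f a, g a)) ` A \<union> (\<lambda>a. (f a, - g a)) ` A) = dim (f ` A) + dim (g ` A)"
proof -
  let ?P = "(\<lambda>a. (f a, g a)) ` A \<union> (\<lambda>a. (f a, - g a)) ` A"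
  have "span ?P = span (f ` A) \<times> span (g ` A)"
  proof
    show "span ?P \<subseteq> span (f ` A) \<times> span (g ` A)"
      by (intro span_minimal subspace_Times subspace_span) (auto intro: span_base span_neg)
    have sf: "(f a, 0) \<in> span ?P" and sg: "(0, g a) \<in> span ?P" if "a \<in> A" for a
    proof -
      have p: "(f a, g a) \<in> span ?P" "(f a, - g a) \<in> span ?P" using that by (auto intro: span_base)
      have "(1/2) *\<^sub>R ((f a, g a) + (f a, - g a)) \<in> span ?P"
        using p by (intro span_scale span_add)
      then show "(f a, 0) \<in> span ?P" by (simp flip: scaleR_2)
      have "(1/2) *\<^sub>R ((f a, g a) - (f a, - g a)) \<in> span ?P"
        using p by (intro span_scale span_diff)
      then show "(0, g a) \<in> span ?P" by (simp flip: scaleR_2)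
    qed
    have "(s, 0) \<in> span ?P" if "s \<in> span (f ` A)" for s
      using that
    proof (induction rule: span_induct)
      show "subspace {s. (s, 0) \<in> span ?P}"
        unfolding subspace_def
        using span_add[of "(_, 0)" ?P "(_, 0)"] span_scale[of "(_, 0)" ?P] span_zero[of ?P]
        by (simp add: zero_prod_def)
    qed (use sf in auto)
    moreover have "(0, t) \<in> span ?P" if "t \<in> span (g ` A)" for t
      using that
    proof (induction rule: span_induct)
      show "subspace {t. (0, t) \<in> span ?P}"
        unfolding subspace_def
        using span_add[of "(0, _)" ?P "(0, _)"] span_scale[of "(0, _)" ?P] span_zero[of ?P]
        by (simp add: zero_prod_def)
    qed (use sg in auto)
    ultimately have "(s, 0) + (0, t) \<in> span ?P" if "s \<in> span (f ` A)" "t \<in> span (g ` A)" for s t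
      using that by (intro span_add)
    then show "span (f ` A) \<times> span (g ` A) \<subseteq> span ?P" by auto
  qed
  then have "dim (span ?P) = dim (span (f ` A)) + dim (span (g ` A))"
    by (simp only: dim_Times subspace_span)
  then show ?thesis by (simp only: dim_span)
qed

text \<open>With weights 1 and \<open>side\<close> this extracts the parts of a vector that are even
  and odd under the swap of the two vertices of an orbit.\<close>

definition orbit_sum ::
    "'v::finite set \<Rightarrow> ('v \<Rightarrow> 'o::finite) \<Rightarrow> ('v \<Rightarrow> real) \<Rightarrow> real^2 \<Rightarrow> real^('v \<times> 2) \<Rightarrow> real^'o" where
  "orbit_sum V orb c d f = (\<chi> O'. \<Sum>w | w \<in> V \<and> orb w = O'. c w * (d \<bullet> (\<chi> i. f $ (w, i))))"

lemma linear_orbit_sum: "linear (orbit_sum V orb c d)"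
proof (rule linearI)
  show "orbit_sum V orb c d (f + g) = orbit_sum V orb c d f + orbit_sum V orb c d g" for f g
    by (simp add: orbit_sum_def vec_eq_iff inner_vec_def distrib_left sum.distrib)
  show "orbit_sum V orb c d (r *\<^sub>R f) = r *\<^sub>R orbit_sum V orb c d f" for r f
    by (simp add: orbit_sum_def vec_eq_iff inner_vec_def sum_distrib_left mult_ac)
qed

lemma orbit_sum_rigidity_row:
  fixes q :: "'v::finite \<Rightarrow> real^2"
  assumes "{a, b} \<in> E" "a \<noteq> b" "a \<in> V" "b \<in> V"
  shows "orbit_sum V orb c d (rigidity_matrix E q $ {a, b}) =
    (d \<bullet> (q a - q b)) *\<^sub>R (c a *\<^sub>R axis (orb a) 1 - c b *\<^sub>R axis (orb b) 1)"
proof -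
  let ?D = "q a - q b"
  have row: "(\<chi> i. rigidity_matrix E q $ {a, b} $ (w, i)) =
      (if w = a then ?D else 0) - (if w = b then ?D else 0)" for w
    using assms(2) by (auto simp: rigidity_matrix_edge[OF assms(1,2)] vec_eq_iff)
  have "orbit_sum V orb c d (rigidity_matrix E q $ {a, b}) $ O' =
      ((d \<bullet> ?D) *\<^sub>R (c a *\<^sub>R axis (orb a) 1 - c b *\<^sub>R axis (orb b) 1)) $ O'" for O'
  proof -
    have "orbit_sum V orb c d (rigidity_matrix E q $ {a, b}) $ O' =
        (\<Sum>w | w \<in> V \<and> orb w = O'. (if w = a then c a * (d \<bullet> ?D) else 0) - (if w = b then c b * (d \<bullet> ?D) else 0))"
      unfolding orbit_sum_def by (simp add: row) (intro sum.cong, auto simp: inner_diff_right algebra_simps)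
    also have "\<dots> = (if orb a = O' then c a * (d \<bullet> ?D) else 0) - (if orb b = O' then c b * (d \<bullet> ?D) else 0)"
      using assms(3,4) by (simp add: sum_subtractf)
    finally show ?thesis by (auto simp: axis_def algebra_simps)
  qed
  then show ?thesis by (simp add: vec_eq_iff)
qed

context
  fixes V :: "'v::finite set" and E :: "'v set set" and \<theta> :: "bit \<Rightarrow> 'v \<Rightarrow> 'v"
    and R :: "'v set" and H :: "('v set, 'v set set) pre_digraph" and \<psi> :: "'v set set \<Rightarrow> bit"
  assumes graph: "simple_graph V E" and action: "graph_action V E \<theta>" and free: "free_on V \<theta>"
    and quotient: "quotient_gain_graph V E \<theta> R H \<psi>"
begin

text \<open>On \<open>V\<close> this is the sign of the group element that carries the
  representative of the orbit to \<open>w\<close>.\<close>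

definition side :: "'v \<Rightarrow> real" where
  "side w = (if w \<in> R then 1 else -1)"

lemma side_square: "side w * side w = 1" "side w * (side w * z) = z" "side w \<noteq> 0"
  by (auto simp: side_def)

lemma action_mem: "v \<in> V \<Longrightarrow> \<theta> g v \<in> V"
  using action unfolding graph_action_def graph_automorphism_def by (meson bij_betwE)

lemma action_zero: "v \<in> V \<Longrightarrow> \<theta> 0 v = v"
  using action by (simp add: graph_action_def)

lemma action_add: "v \<in> V \<Longrightarrow> \<theta> (g + h) v = \<theta> g (\<theta> h v)"
  using action by (simp add: graph_action_def)

lemma action_edge: "u \<in> V \<Longrightarrow> v \<in> V \<Longrightarrow> {\<theta> g u, \<theta> g v} \<in> E \<longleftrightarrow> {u, v} \<in> E"
  using action by (auto simp: graph_action_def graph_automorphism_def)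

lemma action_one_one: "v \<in> V \<Longrightarrow> \<theta> 1 (\<theta> 1 v) = v"
  using action_add[of v 1 1] action_zero by simp

lemma action_one_neq: "v \<in> V \<Longrightarrow> \<theta> 1 v \<noteq> v"
  using free by (auto simp: free_on_def)

lemma vertex_orbit_eq:
  assumes "v \<in> V" shows "vertex_orbit \<theta> v = {v, \<theta> 1 v}"
proof
  have "\<theta> g v \<in> {v, \<theta> 1 v}" for g by (cases g) (simp_all add: action_zero[OF assms])
  then show "vertex_orbit \<theta> v \<subseteq> {v, \<theta> 1 v}" by (auto simp: vertex_orbit_def)
  have "\<theta> 0 v \<in> vertex_orbit \<theta> v" "\<theta> 1 v \<in> vertex_orbit \<theta> v"
    unfolding vertex_orbit_def by (rule rangeI)+
  then show "{v, \<theta> 1 v} \<subseteq> vertex_orbit \<theta> v" by (simp add: action_zero[OF assms])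
qed

lemma vertex_orbit_action:
  assumes v: "v \<in> V" shows "vertex_orbit \<theta> (\<theta> g v) = vertex_orbit \<theta> v"
proof (cases "g = 0")
  case True then show ?thesis by (simp add: action_zero[OF v])
next
  case False
  then have "g = 1" by simp
  then show ?thesis
    unfolding vertex_orbit_eq[OF v] vertex_orbit_eq[OF action_mem[OF v]]
    by (simp add: action_one_one[OF v] insert_commute)
qed

lemma orbit_vertices:
  assumes v: "v \<in> V" shows "{w. w \<in> V \<and> vertex_orbit \<theta> w = vertex_orbit \<theta> v} = {v, \<theta> 1 v}"
proof
  have "w \<in> {v, \<theta> 1 v}" if "w \<in> V" "vertex_orbit \<theta> w = vertex_orbit \<theta> v" for w
    using vertex_orbit_eq[OF that(1)] vertex_orbit_eq[OF v] that(2) by blast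
  then show "{w. w \<in> V \<and> vertex_orbit \<theta> w = vertex_orbit \<theta> v} \<subseteq> {v, \<theta> 1 v}" by blast
  show "{v, \<theta> 1 v} \<subseteq> {w. w \<in> V \<and> vertex_orbit \<theta> w = vertex_orbit \<theta> v}"
    using v action_mem[OF v] vertex_orbit_action[OF v] by blast
qed

lemma representatives_subset: "R \<subseteq> V"
  using quotient by (simp add: quotient_gain_graph_def)

text \<open>By freeness the orbit of \<open>v\<close> has two members, and exactly one of them is
  the representative.\<close>

lemma side_action: 
  assumes "v \<in> V"
  shows "side (\<theta> g v) = gain_sign g * side v"
proof -
  have "\<exists>!r. r \<in> R \<and> r \<in> {v, \<theta> 1 v}"
    using quotient assms vertex_orbit_eq[OF assms] unfolding quotient_gain_graph_def by metis
  then have "\<theta> 1 v \<in> R \<longleftrightarrow> v \<notin> R" using action_one_neq[OF assms] by blast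
  then show ?thesis using assms by (cases g) (auto simp: side_def action_zero)
qed

lemma edge_ends:
  assumes "{a, b} \<in> E" shows "a \<noteq> b" "a \<in> V" "b \<in> V"
proof -
  obtain u v where "u \<in> V" "v \<in> V" "u \<noteq> v" "{a, b} = {u, v}"
    using graph assms unfolding simple_graph_def by blast
  then show "a \<noteq> b" "a \<in> V" "b \<in> V" by (auto simp: doubleton_eq_iff)
qed

lemma arcs_quotient: "arcs H = edge_orbit \<theta> ` E"
  using quotient unfolding quotient_gain_graph_def by (elim conjE)

lemma edge_cases:
  assumes "e \<in> E"
  obtains x y where "e = {x, y}" "x \<in> V" "y \<in> V"
  using graph assms unfolding simple_graph_def by blast

lemma arc_cases:
  assumes a: "a \<in> arcs H"
  obtains u v where "u \<in> R" "v \<in> R" "a = {{\<theta> g u, \<theta> (g + \<psi> a) v} | g. True}" "a \<subseteq> E"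
    "tail H a = vertex_orbit \<theta> u" "head H a = vertex_orbit \<theta> v"
proof -
  have "\<forall>a\<in>arcs H. \<exists>u\<in>R. \<exists>v\<in>R. \<exists>h. a = {{\<theta> \<gamma> u, \<theta> (\<gamma> + h) v} | \<gamma>. True} \<and>
      tail H a = vertex_orbit \<theta> u \<and> head H a = vertex_orbit \<theta> v \<and> \<psi> a = h"
    using quotient unfolding quotient_gain_graph_def by (elim conjE)
  from bspec[OF this a] obtain u v h where uv: "u \<in> R" "v \<in> R"
    "a = {{\<theta> \<gamma> u, \<theta> (\<gamma> + h) v} | \<gamma>. True}"
    "tail H a = vertex_orbit \<theta> u" "head H a = vertex_orbit \<theta> v" "\<psi> a = h"
    by (elim bexE exE conjE)
  obtain e where e: "e \<in> E" "a = edge_orbit \<theta> e"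
    using a unfolding arcs_quotient by (elim imageE)
  obtain x y where xy: "e = {x, y}" "x \<in> V" "y \<in> V" using edge_cases[OF e(1)] .
  have "\<theta> g ` e \<in> E" for g using e(1) action_edge[OF xy(2,3)] by (simp add: xy(1))
  then have "a \<subseteq> E" unfolding e(2) edge_orbit_def by blast
  with uv(1,2,4,5) uv(3)[folded uv(6)] show thesis by (intro that)
qed

lemma edge_in_arc:
  assumes e: "e \<in> E" shows "edge_orbit \<theta> e \<in> arcs H" "e \<in> edge_orbit \<theta> e"
proof -
  show "edge_orbit \<theta> e \<in> arcs H" unfolding arcs_quotient using e by (rule imageI)
  obtain x y where "e = {x, y}" "x \<in> V" "y \<in> V" using edge_cases[OF e] .
  then have "\<theta> 0 ` e = e" by (simp add: action_zero)
  then show "e \<in> edge_orbit \<theta> e" unfolding edge_orbit_def by (metis rangeI)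
qed

section \<open>Symmetry blocks in coordinates along (\<open>t\<close>) and across (\<open>m\<close>)
  the mirror\<close>

context
  fixes t m :: "real^2"
  assumes frame: "\<And>z. z = (z \<bullet> t) *\<^sub>R t + (z \<bullet> m) *\<^sub>R m"
begin

lemma frame_eq_0_iff: "z = 0 \<longleftrightarrow> t \<bullet> z = 0 \<and> m \<bullet> z = 0"
proof
  assume "t \<bullet> z = 0 \<and> m \<bullet> z = 0"
  then have "(z \<bullet> t) *\<^sub>R t + (z \<bullet> m) *\<^sub>R m = 0" by (simp add: inner_commute)
  then show "z = 0" by (rule trans[OF frame])
qed simp

text \<open>A symmetric realization is determined by one point per orbit: the reflection keeps the
  coordinate along the mirror and negates the other, and \<open>side\<close> keeps track of that
  sign.\<close>

definition orbit_coordinates :: "('v \<Rightarrow> real^2) \<Rightarrow> (real^('v set)) \<times> (real^('v set)) \<Rightarrow> bool" where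
  "orbit_coordinates q h \<longleftrightarrow> (\<forall>w\<in>V. t \<bullet> q w = fst h $ vertex_orbit \<theta> w \<and>
     m \<bullet> q w = side w * snd h $ vertex_orbit \<theta> w)"

text \<open>Coordinates adapted to the two characters of the group. A symmetric vector has equal
  entries along the mirror and opposite entries across it, which fixes the weights of the first
  pair; the second pair is antisymmetric.\<close>

definition symmetry_blocks ::
    "real^('v \<times> 2) \<Rightarrow> ((real^('v set)) \<times> (real^('v set))) \<times> ((real^('v set)) \<times> (real^('v set)))" where
  "symmetry_blocks f =
    ((orbit_sum V (vertex_orbit \<theta>) (\<lambda>_. 1) t f, orbit_sum V (vertex_orbit \<theta>) side m f),
     (orbit_sum V (vertex_orbit \<theta>) side t f, orbit_sum V (vertex_orbit \<theta>) (\<lambda>_. 1) m f))"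

lemma linear_symmetry_blocks: "linear symmetry_blocks"
proof -
  note * = linear_orbit_sum[THEN linear_add] linear_orbit_sum[THEN linear_scale]
  show ?thesis by (rule linearI) (simp_all add: symmetry_blocks_def *)
qed

context
  fixes q :: "'v \<Rightarrow> real^2" and h :: "(real^('v set)) \<times> (real^('v set))" and u v :: 'v
    and a :: "'v set set" and g :: bit
  assumes q: "orbit_coordinates q h" and u: "u \<in> R" and v: "v \<in> R"
    and arc: "tail H a = vertex_orbit \<theta> u" "head H a = vertex_orbit \<theta> v"
begin

lemma end_sides:
  "side (\<theta> g u) = gain_sign g" "side (\<theta> (g + \<psi> a) v) = gain_sign g * gain_sign (\<psi> a)"
proof -
  have "side u = 1" "side v = 1" "u \<in> V" "v \<in> V"
    using u v representatives_subset by (auto simp: side_def)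
  then show "side (\<theta> g u) = gain_sign g" "side (\<theta> (g + \<psi> a) v) = gain_sign g * gain_sign (\<psi> a)"
    by (simp_all only: side_action gain_sign_add mult_1_right)
qed

lemma end_orbits:
  "vertex_orbit \<theta> (\<theta> g u) = tail H a" "vertex_orbit \<theta> (\<theta> (g + \<psi> a) v) = head H a"
  using u v representatives_subset unfolding arc by (auto intro!: vertex_orbit_action)

lemma edge_coordinates:
  shows "t \<bullet> (q (\<theta> g u) - q (\<theta> (g + \<psi> a) v)) = incidence H (\<lambda>_. 0) a \<bullet> fst h"
    and "m \<bullet> (q (\<theta> g u) - q (\<theta> (g + \<psi> a) v)) = gain_sign g * (incidence H \<psi> a \<bullet> snd h)"
proof -
  have V: "\<theta> g u \<in> V" "\<theta> (g + \<psi> a) v \<in> V" using u v representatives_subset by (auto intro!: action_mem)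
  have coords: "t \<bullet> q w = fst h $ vertex_orbit \<theta> w" "m \<bullet> q w = side w * snd h $ vertex_orbit \<theta> w"
    if "w \<in> V" for w
    using q that by (simp_all add: orbit_coordinates_def)
  show "t \<bullet> (q (\<theta> g u) - q (\<theta> (g + \<psi> a) v)) = incidence H (\<lambda>_. 0) a \<bullet> fst h"
    unfolding inner_diff_right coords[OF V(1)] coords[OF V(2)] end_orbits inner_incidence by simp
  show "m \<bullet> (q (\<theta> g u) - q (\<theta> (g + \<psi> a) v)) = gain_sign g * (incidence H \<psi> a \<bullet> snd h)"
    unfolding inner_diff_right coords[OF V(1)] coords[OF V(2)] end_orbits end_sides inner_incidence
    by (simp add: algebra_simps)
qed

text \<open>In the symmetric block the sign of \<open>g\<close> enters twice across the mirror,
  through \<open>side\<close> and through the edge vector, and cancels. In the antisymmetric block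
  it enters each component once.\<close>

lemma symmetry_blocks_row:
  assumes e: "{\<theta> g u, \<theta> (g + \<psi> a) v} \<in> E"
  shows "symmetry_blocks (rigidity_matrix E q $ {\<theta> g u, \<theta> (g + \<psi> a) v}) =
    (sym_row H \<psi> h a, gain_sign g *\<^sub>R antisym_row H \<psi> h a)"
  unfolding symmetry_blocks_def orbit_sum_rigidity_row[OF e edge_ends[OF e]] edge_coordinates
    end_sides end_orbits
  by (simp add: sym_row_def antisym_row_def incidence_def[of H] algebra_simps)

end

text \<open>Sum and difference over a two-element orbit determine both entries. The columns outside
  \<open>V\<close> are invisible to the blocks and must be zero.\<close>

lemma inj_on_symmetry_blocks: "inj_on symmetry_blocks {f. \<forall>w i. w \<notin> V \<longrightarrow> f $ (w, i) = 0}"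
proof (rule inj_onI)
  fix f f' assume f: "f \<in> {f. \<forall>w i. w \<notin> V \<longrightarrow> f $ (w, i) = 0}" "f' \<in> {f. \<forall>w i. w \<notin> V \<longrightarrow> f $ (w, i) = 0}"
    and eq: "symmetry_blocks f = symmetry_blocks f'"
  define g where "g = f - f'"
  have "symmetry_blocks g = 0"
    using eq by (simp add: g_def linear_diff[OF linear_symmetry_blocks])
  then have z: "orbit_sum V (vertex_orbit \<theta>) (\<lambda>_. 1) t g = 0" "orbit_sum V (vertex_orbit \<theta>) side m g = 0"
    "orbit_sum V (vertex_orbit \<theta>) side t g = 0" "orbit_sum V (vertex_orbit \<theta>) (\<lambda>_. 1) m g = 0"
    by (simp_all add: symmetry_blocks_def zero_prod_def)
  have "g $ (w, i) = 0" for w i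
  proof (cases "w \<in> V")
    case True
    define F F' where "F = (\<chi> i. g $ (w, i))" and "F' = (\<chi> i. g $ (\<theta> 1 w, i))"
    have os: "orbit_sum V (vertex_orbit \<theta>) c d g $ vertex_orbit \<theta> w = c w * (d \<bullet> F) + c (\<theta> 1 w) * (d \<bullet> F')" for c d
      unfolding orbit_sum_def F_def F'_def
      using action_one_neq[OF True] by (simp add: orbit_vertices[OF True])
    have "t \<bullet> F + t \<bullet> F' = 0" "m \<bullet> F + m \<bullet> F' = 0"
      using os[of "\<lambda>_. 1" t] os[of "\<lambda>_. 1" m] z by simp_all
    moreover have "side w * (t \<bullet> F - t \<bullet> F') = 0" "side w * (m \<bullet> F - m \<bullet> F') = 0"
      using os[of side t] os[of side m] z side_action[OF True, of 1]
      by (simp_all add: right_diff_distrib del: mult_eq_0_iff)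
    ultimately have "t \<bullet> F = 0" "m \<bullet> F = 0" using side_square(3)[of w] by auto
    then have "F = 0" using frame_eq_0_iff by blast
    then show ?thesis by (simp add: F_def vec_eq_iff)
  next
    case False
    then show ?thesis using f by (simp add: g_def)
  qed
  then have "g = 0" by (simp add: vec_eq_iff)
  then show "f = f'" by (simp add: g_def)
qed

text \<open>The change of coordinates is injective on the row space, so it preserves the rank. It
  sends the rows of an edge orbit to the symmetric row paired with plus and minus the antisymmetric
  row; for a fixed edge, a loop of the quotient, the latter is zero and the two agree.\<close>

lemma rank_rigidity_matrix_blocks:
  assumes q: "orbit_coordinates q h"
  shows "rank (rigidity_matrix E q) = dim (sym_row H \<psi> h ` arcs H) + dim (antisym_row H \<psi> h ` arcs H)"
proof -
  let ?row = "\<lambda>e. rigidity_matrix E q $ e"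
  let ?Z = "{f :: real^('v \<times> 2). \<forall>w i. w \<notin> V \<longrightarrow> f $ (w, i) = 0}"
  let ?P = "(\<lambda>a. (sym_row H \<psi> h a, antisym_row H \<psi> h a)) ` arcs H \<union>
    (\<lambda>a. (sym_row H \<psi> h a, - antisym_row H \<psi> h a)) ` arcs H"
  have "subspace ?Z" by (auto simp: subspace_def)
  moreover have "?row ` E \<subseteq> ?Z"
  proof clarify
    fix e w i assume e: "e \<in> E" "w \<notin> V"
    then have "w \<notin> e" using edge_cases[OF e(1)] by blast
    then show "?row e $ (w, i) = 0" by (simp add: rigidity_matrix_def)
  qed
  ultimately have "span (?row ` E) \<subseteq> ?Z" by (intro span_minimal)
  then have dims: "dim (symmetry_blocks ` ?row ` E) = dim (?row ` E)"
    by (intro dim_image_eq linear_symmetry_blocks inj_on_subset[OF inj_on_symmetry_blocks])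
  have blocks: "symmetry_blocks ` ?row ` E = ?P"
  proof
    have "symmetry_blocks (?row e) \<in> ?P" if e: "e \<in> E" for e
    proof -
      let ?a = "edge_orbit \<theta> e"
      have a: "?a \<in> arcs H" "e \<in> ?a" using edge_in_arc[OF e] by auto
      obtain u v where uv: "u \<in> R" "v \<in> R" "?a = {{\<theta> g u, \<theta> (g + \<psi> ?a) v} | g. True}" "?a \<subseteq> E"
        "tail H ?a = vertex_orbit \<theta> u" "head H ?a = vertex_orbit \<theta> v"
        by (rule arc_cases[OF a(1)])
      obtain g where g: "e = {\<theta> g u, \<theta> (g + \<psi> ?a) v}"
        using a(2) by (subst (asm) uv(3)) blast
      have "symmetry_blocks (?row e) = (sym_row H \<psi> h ?a, gain_sign g *\<^sub>R antisym_row H \<psi> h ?a)"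
        using symmetry_blocks_row[OF q uv(1,2,5,6), of g] e unfolding g[symmetric] by blast
      then show ?thesis using a(1) by (cases g) auto
    qed
    then show "symmetry_blocks ` ?row ` E \<subseteq> ?P" by blast
    show "?P \<subseteq> symmetry_blocks ` ?row ` E"
    proof -
      have "(sym_row H \<psi> h a, gain_sign g *\<^sub>R antisym_row H \<psi> h a) \<in> symmetry_blocks ` ?row ` E"
        if a: "a \<in> arcs H" for a g
      proof -
        obtain u v where uv: "u \<in> R" "v \<in> R" "a = {{\<theta> g u, \<theta> (g + \<psi> a) v} | g. True}" "a \<subseteq> E"
          "tail H a = vertex_orbit \<theta> u" "head H a = vertex_orbit \<theta> v"
          by (rule arc_cases[OF a])
        have "{\<theta> g u, \<theta> (g + \<psi> a) v} \<in> E" using uv(3,4) by blast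
        then show ?thesis
          using symmetry_blocks_row[OF q uv(1,2,5,6), of g] by (metis imageI)
      qed
      from this[of _ 0] this[of _ 1] show ?thesis by auto
    qed
  qed
  show ?thesis
    unfolding rank_rigidity_matrix dims[symmetric] blocks by (rule dim_signed_pairs)
qed

lemma framework_iff_nondegenerate:
  assumes q: "orbit_coordinates q h"
  shows "framework V E q \<longleftrightarrow> nondegenerate H \<psi> h"
proof -
  have zero: "q x - q y = 0 \<longleftrightarrow> t \<bullet> (q x - q y) = 0 \<and> m \<bullet> (q x - q y) = 0" for x y
    by (rule frame_eq_0_iff)
  have edge: "q (\<theta> g u) \<noteq> q (\<theta> (g + \<psi> a) v) \<longleftrightarrow>
      incidence H (\<lambda>_. 0) a \<bullet> fst h \<noteq> 0 \<or> incidence H \<psi> a \<bullet> snd h \<noteq> 0"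
    if "u \<in> R" "v \<in> R" "tail H a = vertex_orbit \<theta> u" "head H a = vertex_orbit \<theta> v" for a g u v
    using zero[of "\<theta> g u" "\<theta> (g + \<psi> a) v"] edge_coordinates[OF q that, of g] by simp
  show ?thesis
  proof
    assume fw: "framework V E q"
    show "nondegenerate H \<psi> h"
      unfolding nondegenerate_def
    proof
      fix a assume a: "a \<in> arcs H"
      obtain u v where uv: "u \<in> R" "v \<in> R" "a = {{\<theta> g u, \<theta> (g + \<psi> a) v} | g. True}" "a \<subseteq> E"
        "tail H a = vertex_orbit \<theta> u" "head H a = vertex_orbit \<theta> v"
        by (rule arc_cases[OF a])
      then have "{\<theta> 0 u, \<theta> (0 + \<psi> a) v} \<in> E" by blast
      then show "incidence H (\<lambda>_. 0) a \<bullet> fst h \<noteq> 0 \<or> incidence H \<psi> a \<bullet> snd h \<noteq> 0"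
        using edge[OF uv(1,2,5,6), of 0] fw by (simp add: framework_def)
    qed
  next
    assume nd: "nondegenerate H \<psi> h"
    have "q x \<noteq> q y" if e: "{x, y} \<in> E" for x y
    proof -
      let ?a = "edge_orbit \<theta> {x, y}"
      have a: "?a \<in> arcs H" "{x, y} \<in> ?a" using edge_in_arc[OF e] by auto
      obtain u v where uv: "u \<in> R" "v \<in> R" "?a = {{\<theta> g u, \<theta> (g + \<psi> ?a) v} | g. True}" "?a \<subseteq> E"
        "tail H ?a = vertex_orbit \<theta> u" "head H ?a = vertex_orbit \<theta> v"
        by (rule arc_cases[OF a(1)])
      obtain g where g: "{x, y} = {\<theta> g u, \<theta> (g + \<psi> ?a) v}"
        using a(2) by (subst (asm) uv(3)) blast
      have "q (\<theta> g u) \<noteq> q (\<theta> (g + \<psi> ?a) v)"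
        using edge[OF uv(1,2,5,6), of g] nd a(1) by (simp add: nondegenerate_def)
      then show ?thesis using g by (auto simp: doubleton_eq_iff)
    qed
    then show "framework V E q" using graph by (auto simp: framework_def)
  qed
qed

lemma orbit_coordinates_of_symmetric:
  assumes "\<And>z. t \<bullet> s z = t \<bullet> z" "\<And>z. m \<bullet> s z = - (m \<bullet> z)" "\<And>w. w \<in> V \<Longrightarrow> q (\<theta> 1 w) = s (q w)"
  shows "\<exists>h. orbit_coordinates q h"
proof -
  have *: "\<exists>x y. \<forall>w\<in>V. vertex_orbit \<theta> w = O' \<longrightarrow> t \<bullet> q w = x \<and> m \<bullet> q w = side w * y" for O'
  proof (cases "\<exists>v\<in>V. vertex_orbit \<theta> v = O'")
    case True
    then obtain v where v: "v \<in> V" "vertex_orbit \<theta> v = O'" by blast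
    \<comment> \<open>The value \<open>side v * (m \<bullet> q v)\<close> is the coordinate of the
      representative, the same for both vertices \<open>v\<close> of the orbit.\<close>
    have "t \<bullet> q w = t \<bullet> q v \<and> m \<bullet> q w = side w * (side v * (m \<bullet> q v))"
      if "w \<in> V" "vertex_orbit \<theta> w = O'" for w
    proof -
      have "w = v \<or> w = \<theta> 1 v" using that v orbit_vertices[OF v(1)] by blast
      then show ?thesis using assms v(1) side_action[OF v(1), of 1] side_square by auto
    qed
    then show ?thesis by blast
  qed blast
  then obtain X Y where "\<And>O' w. w \<in> V \<Longrightarrow> vertex_orbit \<theta> w = O' \<Longrightarrow>
      t \<bullet> q w = X O' \<and> m \<bullet> q w = side w * Y O'"
    by metis
  then have "orbit_coordinates q (\<chi> O'. X O', \<chi> O'. Y O')" by (simp add: orbit_coordinates_def)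
  then show ?thesis by blast
qed

lemma symmetric_of_orbit_coordinates:
  assumes s: "\<And>z. s z = (t \<bullet> z) *\<^sub>R t - (m \<bullet> z) *\<^sub>R m"
    and orth: "t \<bullet> t = 1" "m \<bullet> m = 1" "t \<bullet> m = 0"
  shows "\<exists>q. orbit_coordinates q h \<and> (\<forall>w\<in>V. q (\<theta> 1 w) = s (q w))"
proof -
  define q where "q w = fst h $ vertex_orbit \<theta> w *\<^sub>R t + (side w * snd h $ vertex_orbit \<theta> w) *\<^sub>R m" for w
  have "orbit_coordinates q h"
    using orth by (simp add: orbit_coordinates_def q_def inner_add_right inner_commute[of m t])
  moreover have "q (\<theta> 1 w) = s (q w)" if "w \<in> V" for w
    using that orth side_action[OF that, of 1]
    by (simp add: s q_def inner_add_right inner_commute[of m t] vertex_orbit_action)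
  ultimately show ?thesis by blast
qed

end
end

text \<open>The unit normal \<open>m\<close> of the mirror and its quarter turn \<open>t\<close>
  form an orthonormal basis of eigenvectors of the reflection.\<close>

lemma reflection_frame:
  assumes "n \<noteq> 0"
  obtains t m :: "real^2" where "\<And>z. z = (z \<bullet> t) *\<^sub>R t + (z \<bullet> m) *\<^sub>R m"
    "t \<bullet> t = 1" "m \<bullet> m = 1" "t \<bullet> m = 0"
    "\<And>z. reflection_matrix n *v z = (t \<bullet> z) *\<^sub>R t - (m \<bullet> z) *\<^sub>R m"
proof -
  define m where "m = (1 / norm n) *\<^sub>R n"
  define t where "t = (vector [- m $ 2, m $ 1] :: real^2)"
  have mm: "m \<bullet> m = 1"
    using assms by (simp add: m_def power2_norm_eq_inner[symmetric] power2_eq_square)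
  then have mm': "m $ 1 * m $ 1 + m $ 2 * m $ 2 = 1" by (simp add: inner_vec_def sum_2)
  have tt: "t \<bullet> t = 1" "t \<bullet> m = 0"
    using mm' by (simp_all add: t_def inner_vec_def sum_2 algebra_simps)
  have frame: "z = (z \<bullet> t) *\<^sub>R t + (z \<bullet> m) *\<^sub>R m" for z
  proof -
    have "(z \<bullet> t) * t $ 1 + (z \<bullet> m) * m $ 1 = z $ 1 * (m $ 1 * m $ 1 + m $ 2 * m $ 2)"
      "(z \<bullet> t) * t $ 2 + (z \<bullet> m) * m $ 2 = z $ 2 * (m $ 1 * m $ 1 + m $ 2 * m $ 2)"
      by (simp_all add: t_def inner_vec_def sum_2 algebra_simps)
    then show ?thesis using mm' by (simp add: vec_eq_iff forall_2)
  qed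
  have "reflection_matrix n *v z = (t \<bullet> z) *\<^sub>R t - (m \<bullet> z) *\<^sub>R m" for z
  proof -
    have "linear (\<lambda>x. x - (2 * (x \<bullet> n) / (n \<bullet> n)) *\<^sub>R n)"
      by (rule linearI) (auto simp: inner_add_left algebra_simps add_divide_distrib)
    then have "reflection_matrix n *v z = z - (2 * (z \<bullet> n) / (n \<bullet> n)) *\<^sub>R n"
      unfolding reflection_matrix_def by (rule fun_cong[OF matrix_vector_mul(2)])
    also have "(2 * (z \<bullet> n) / (n \<bullet> n)) *\<^sub>R n = (2 * (z \<bullet> m)) *\<^sub>R m"
      using assms by (simp add: m_def power2_norm_eq_inner[symmetric] power2_eq_square)
    also have "z - (2 * (z \<bullet> m)) *\<^sub>R m = (z \<bullet> t) *\<^sub>R t + (z \<bullet> m) *\<^sub>R m - (2 * (z \<bullet> m)) *\<^sub>R m"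
      using frame[of z] by simp
    also have "\<dots> = (t \<bullet> z) *\<^sub>R t - (m \<bullet> z) *\<^sub>R m"
      by (simp only: mult_2 scaleR_add_left inner_commute[of z]) simp
    finally show ?thesis .
  qed
  then show thesis using that frame tt mm by blast
qed

text \<open>Since \<open>1 + 1 = 0\<close>, the value \<open>\<tau> 1 = mat 1\<close> would give
  \<open>\<tau> 0 = mat 1\<close> as well, against injectivity.\<close>

lemma faithful_bit_representation:
  fixes \<tau> :: "bit \<Rightarrow> real^2^2"
  assumes "faithful_representation \<tau> (reflection_group n)"
  shows "\<tau> 0 = mat 1" "\<tau> 1 = reflection_matrix n"
proof -
  have r: "\<tau> g = mat 1 \<or> \<tau> g = reflection_matrix n" for g
    using assms by (auto simp: faithful_representation_def reflection_group_def)
  have mult: "\<tau> (g + h) = \<tau> g ** \<tau> h" for g h using assms by (auto simp: faithful_representation_def)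
  have ne: "\<tau> 0 \<noteq> \<tau> 1" using assms by (auto simp: faithful_representation_def inj_def)
  have "\<tau> 1 \<noteq> mat 1" using mult[of 1 1] ne by auto
  then show "\<tau> 1 = reflection_matrix n" using r by blast
  then show "\<tau> 0 = mat 1" using r[of 0] ne by auto
qed

theorem theorem6p4:
  fixes V :: "'v::finite set" and E :: "'v set set"
    and \<theta> :: "bit \<Rightarrow> 'v \<Rightarrow> 'v" and \<tau> :: "bit \<Rightarrow> real^2^2" and n :: "real^2"
    and p :: "'v \<Rightarrow> real^2"
    and R :: "'v set" and H :: "('v set, 'v set set) pre_digraph" and \<psi> :: "'v set set \<Rightarrow> bit"
  assumes "n \<noteq> 0"
    and "faithful_representation \<tau> (reflection_group n)"
    and "simple_graph V E"
    and "graph_action V E \<theta>"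
    and "free_on V \<theta>"
    and "symmetric_regular V E \<theta> \<tau> p"
    and "quotient_gain_graph V E \<theta> R H \<psi>"
  shows "rank (rigidity_matrix E p) =
    gain_matroid_rank H \<psi> 2 3 1 + gain_matroid_rank H \<psi> 2 3 2"
proof -
  obtain t m :: "real^2" where frame: "\<And>z. z = (z \<bullet> t) *\<^sub>R t + (z \<bullet> m) *\<^sub>R m"
    and orth: "t \<bullet> t = 1" "m \<bullet> m = 1" "t \<bullet> m = 0"
    and refl: "\<And>z. reflection_matrix n *v z = (t \<bullet> z) *\<^sub>R t - (m \<bullet> z) *\<^sub>R m"
    using reflection_frame[OF assms(1)] by metis
  note \<tau> = faithful_bit_representation[OF assms(2)]
  note G = assms(3,4,5,7)
  have sym: "symmetric_framework V E \<theta> \<tau> q \<longleftrightarrow>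
      framework V E q \<and> (\<forall>w\<in>V. q (\<theta> 1 w) = reflection_matrix n *v q w)" for q
  proof -
    have "(\<forall>\<gamma>. \<forall>w\<in>V. \<tau> \<gamma> *v q w = q (\<theta> \<gamma> w)) \<longleftrightarrow>
        (\<forall>w\<in>V. q (\<theta> 1 w) = reflection_matrix n *v q w)" (is "?L \<longleftrightarrow> ?R")
    proof
      assume ?L then show ?R unfolding \<tau>(2)[symmetric] by (metis (no_types))
    next
      assume ?R
      show ?L
      proof
        fix \<gamma> :: bit
        show "\<forall>w\<in>V. \<tau> \<gamma> *v q w = q (\<theta> \<gamma> w)"
          using \<open>?R\<close> action_zero[OF G] by (cases \<gamma>) (simp_all add: \<tau>)
      qed
    qed
    then show ?thesis by (simp only: symmetric_framework_def)
  qed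
  have p: "symmetric_framework V E \<theta> \<tau> p"
    and max: "\<And>q. symmetric_framework V E \<theta> \<tau> q \<Longrightarrow>
      rank (rigidity_matrix E q) \<le> rank (rigidity_matrix E p)"
    using assms(6) by (auto simp: symmetric_regular_def)
  have s: "t \<bullet> (reflection_matrix n *v z) = t \<bullet> z" "m \<bullet> (reflection_matrix n *v z) = - (m \<bullet> z)" for z
    using orth by (simp_all add: refl inner_diff_right inner_commute[of m t])
  \<comment> \<open>The coordinates of the given framework serve twice: they bound its rank from
    above, and they show that nondegenerate points exist, so that generic points are
    nondegenerate.\<close>
  obtain h0 where h0: "orbit_coordinates V \<theta> R t m p h0"
    using orbit_coordinates_of_symmetric[OF G frame s] p sym by metis
  have nd: "nondegenerate H \<psi> h0"
    using framework_iff_nondegenerate[OF G frame h0] p sym by blast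
  have "rank (rigidity_matrix E p) \<le> gain_matroid_rank H \<psi> 2 3 1 + gain_matroid_rank H \<psi> 2 3 2"
    unfolding rank_rigidity_matrix_blocks[OF G frame h0]
    by (intro add_mono dim_rows_le nd)
  moreover obtain h where h: "nondegenerate H \<psi> h"
    "gain_matroid_rank H \<psi> 2 3 1 \<le> dim (sym_row H \<psi> h ` arcs H)"
    "gain_matroid_rank H \<psi> 2 3 2 \<le> dim (antisym_row H \<psi> h ` arcs H)"
    by (rule ex_generic_realization[OF nd])
  obtain q where q: "orbit_coordinates V \<theta> R t m q h" "\<forall>w\<in>V. q (\<theta> 1 w) = reflection_matrix n *v q w"
    using symmetric_of_orbit_coordinates[OF G frame refl orth] by metis
  \<comment> \<open>The realization \<open>q\<close> of the generic point is an admissible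
    competitor, so regularity of \<open>p\<close> makes its rank a lower bound.\<close>
  have "symmetric_framework V E \<theta> \<tau> q"
    using framework_iff_nondegenerate[OF G frame q(1)] h(1) q(2) sym by blast
  then have "gain_matroid_rank H \<psi> 2 3 1 + gain_matroid_rank H \<psi> 2 3 2 \<le> rank (rigidity_matrix E p)"
    using max[of q] h(2,3) unfolding rank_rigidity_matrix_blocks[OF G frame q(1)] by linarith
  ultimately show ?thesis by linarith
qed

end
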